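(* Let $X=(X_t)_{t\in[0,1]}$ be a real centered continuous Gaussian process with covariance function $k(t,s)=\mathrm{Cov}(X_t,X_s)$. Assume that $X$ enjoys an LDP in small time at speed $g$. Then: (a) For every $s,t$ the limit $$k_0(t,s):=\lim_{\varepsilon\to0}g(\varepsilon)\,k(\varepsilon t,\varepsilon s)$$ exists, and the limit function $k_0$ has the form $$k_0(t,t)=k_0(1,1)\,t^\beta ,$$ with $\beta$ the exponent appearing in (c). In particular $$g(\varepsilon)\sim\frac1{k(\varepsilon,\varepsilon)}\cdot$$ (b) The variance function $t\mapsto k(t,t)$ of $X$, hence also $g$, is a regularly varying function (at $0$). (c) The limit function $k_0$ is a homogeneous function, i.e., for every $\lambda>0$, $$k_0(\lambda t,\lambda s)=\lambda^\beta k_0(t,s),$$ for some $\beta>0$.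
   Context: A speed function is a function $g:\mathbb R^+\to\mathbb R^+$ with $g(\varepsilon)\to+\infty$ as $\varepsilon\to0$. A rate function on a topological space $E$ is a lower semicontinuous $I:E\to[0,+\infty]$ whose level sets $\{I\le a\}$, $a\ge0$, are compact. A family of $E$-valued random variables with laws $(\mu_\varepsilon)_\varepsilon$ satisfies a Large Deviations Principle (LDP) as $\varepsilon\to0$ with speed $g$ and rate function $I$ if $\limsup_{\varepsilon\to0}\frac1{g(\varepsilon)}\log\mu_\varepsilon(F)\le-\inf_FI$ for every closed $F\subset E$ and $\liminf_{\varepsilon\to0}\frac1{g(\varepsilon)}\log\mu_\varepsilon(G)\ge-\inf_GI$ for every open $G\subset E$. $X$ enjoys an LDP in small time at speed $g$ if the family $(X^\varepsilon)_\varepsilon$, $X^\varepsilon=(X_{\varepsilon t})_{t\in[0,1]}$, satisfies an LDP as $\varepsilon\to0$ with speed $g$ (and some rate function) on $\mathcal C([0,1],\mathbb R)$ endowed with the supremum norm. A function $\lambda$ is regularly varying at $0$ of index $\gamma$ if $\lim_{\varepsilon\to0+}\lambda(\varepsilon t)/\lambda(\varepsilon)=t^\gamma$ for every $t>0$.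
   Formalization: The asymptotics of g, regular variation in (b), and limits for s,t>1 assume a rate function finite at some nonzero path (they can fail otherwise, e.g. X=0); g~1/k(ε,ε) is stated as g~k_0(1,1)/k(ε,ε) with k_0(1,1)>0, since a speed is fixed only up to a constant. *)

theory Defs
  imports "HOL-Probability.Probability" "HOL-Library.Landau_Symbols"
begin

section \<open>Large deviations\<close>

definition speed_function :: "(real \<Rightarrow> real) \<Rightarrow> bool" where
  "speed_function g \<longleftrightarrow> (\<forall>\<epsilon>>0. g \<epsilon> > 0) \<and> filterlim g at_top (at_right 0)"

definition lower_semicontinuous_map :: "'b topology \<Rightarrow> ('b \<Rightarrow> ereal) \<Rightarrow> bool" where
  "lower_semicontinuous_map E I \<longleftrightarrow> (\<forall>a. openin E {x \<in> topspace E. a < I x})"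

definition rate_function :: "'b topology \<Rightarrow> ('b \<Rightarrow> ereal) \<Rightarrow> bool" where
  "rate_function E I \<longleftrightarrow>
     (\<forall>x\<in>topspace E. 0 \<le> I x) \<and>
     lower_semicontinuous_map E I \<and>
     (\<forall>a::real. 0 \<le> a \<longrightarrow> compactin E {x \<in> topspace E. I x \<le> ereal a})"

text \<open>Logarithm of a probability, with the convention \<open>log 0 = -\<infinity>\<close>
  (the library's \<open>ln\<close> has \<open>ln 0 = 0\<close>).\<close>

definition log_prob :: "real \<Rightarrow> ereal" where
  "log_prob p = (if p = 0 then -\<infinity> else ereal (ln p))"

definition borel_of_topology :: "'b topology \<Rightarrow> 'b measure" where
  "borel_of_topology E = sigma (topspace E) {U. openin E U}"

text \<open>In \<open>ereal\<close> the infimum over the empty set is \<open>\<infinity>\<close>.\<close>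

definition satisfies_LDP ::
  "'b topology \<Rightarrow> (real \<Rightarrow> 'b measure) \<Rightarrow> (real \<Rightarrow> real) \<Rightarrow> ('b \<Rightarrow> ereal) \<Rightarrow> bool" where
  "satisfies_LDP E \<mu> g I \<longleftrightarrow>
     speed_function g \<and> rate_function E I \<and>
     (\<forall>F. closedin E F \<longrightarrow>
        Limsup (at_right 0) (\<lambda>\<epsilon>. ereal (1 / g \<epsilon>) * log_prob (measure (\<mu> \<epsilon>) F)) \<le> - (INF x\<in>F. I x)) \<and>
     (\<forall>G. openin E G \<longrightarrow>
        - (INF x\<in>G. I x) \<le> Liminf (at_right 0) (\<lambda>\<epsilon>. ereal (1 / g \<epsilon>) * log_prob (measure (\<mu> \<epsilon>) G)))"


section \<open>Gaussian processes\<close>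

text \<open>Gaussian variables may be degenerate, i.e. almost surely constant.\<close>

definition gaussian_rv :: "'a measure \<Rightarrow> ('a \<Rightarrow> real) \<Rightarrow> bool" where
  "gaussian_rv M Y \<longleftrightarrow> Y \<in> borel_measurable M \<and>
     ((\<exists>m. AE \<omega> in M. Y \<omega> = m) \<or>
      (\<exists>m \<sigma>. 0 < \<sigma> \<and> distributed M lborel Y (normal_density m \<sigma>)))"

definition gaussian_process :: "'a measure \<Rightarrow> 't set \<Rightarrow> ('t \<Rightarrow> 'a \<Rightarrow> real) \<Rightarrow> bool" where
  "gaussian_process M T X \<longleftrightarrow>
     (\<forall>J a. finite J \<longrightarrow> J \<subseteq> T \<longrightarrow> gaussian_rv M (\<lambda>\<omega>. \<Sum>t\<in>J. a t * X t \<omega>))"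

definition centered_process :: "'a measure \<Rightarrow> 't set \<Rightarrow> ('t \<Rightarrow> 'a \<Rightarrow> real) \<Rightarrow> bool" where
  "centered_process M T X \<longleftrightarrow> (\<forall>t\<in>T. integral\<^sup>L M (X t) = 0)"

definition continuous_process :: "'a measure \<Rightarrow> real set \<Rightarrow> (real \<Rightarrow> 'a \<Rightarrow> real) \<Rightarrow> bool" where
  "continuous_process M T X \<longleftrightarrow> (\<forall>\<omega>\<in>space M. continuous_on T (\<lambda>t. X t \<omega>))"

definition covariance :: "'a measure \<Rightarrow> ('a \<Rightarrow> real) \<Rightarrow> ('a \<Rightarrow> real) \<Rightarrow> real" where
  "covariance M Y Z =
     integral\<^sup>L M (\<lambda>\<omega>. (Y \<omega> - integral\<^sup>L M Y) * (Z \<omega> - integral\<^sup>L M Z))"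


section \<open>Small time large deviations\<close>

text \<open>The space \<open>C([0,1], \<real>)\<close> with the supremum norm; its points are the continuous
  functions on \<open>{0..1}\<close> that are \<open>undefined\<close> outside \<open>{0..1}\<close>.\<close>

abbreviation C01 :: "(real \<Rightarrow> real) topology" where
  "C01 \<equiv> mtopology_of (cfunspace (top_of_set {0..1::real}) (euclidean_metric :: real metric))"

definition scaled_path :: "(real \<Rightarrow> 'a \<Rightarrow> real) \<Rightarrow> real \<Rightarrow> 'a \<Rightarrow> (real \<Rightarrow> real)" where
  "scaled_path X \<epsilon> \<omega> = (\<lambda>t\<in>{0..1}. X (\<epsilon> * t) \<omega>)"

definition small_time_LDP ::
  "'a measure \<Rightarrow> (real \<Rightarrow> 'a \<Rightarrow> real) \<Rightarrow> (real \<Rightarrow> real) \<Rightarrow> ((real \<Rightarrow> real) \<Rightarrow> ereal) \<Rightarrow> bool" where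
  "small_time_LDP M X g I \<longleftrightarrow>
     (\<forall>\<epsilon>\<in>{0<..1}. scaled_path X \<epsilon> \<in> measurable M (borel_of_topology C01)) \<and>
     satisfies_LDP C01 (\<lambda>\<epsilon>. distr M (borel_of_topology C01) (scaled_path X \<epsilon>)) g I"

text \<open>The rate function that is infinite off the zero path occurs for every speed that is too
  slow for the process.\<close>

definition nontrivial_rate :: "((real \<Rightarrow> real) \<Rightarrow> ereal) \<Rightarrow> bool" where
  "nontrivial_rate I \<longleftrightarrow> (\<exists>x\<in>topspace C01. x \<noteq> (\<lambda>t\<in>{0..1}. 0) \<and> I x < \<infinity>)"

text \<open>Since \<open>x / 0 = 0\<close>, the case \<open>t = 1\<close> below forces \<open>f\<close> to be nonzero near \<open>0\<close>.\<close>

definition regularly_varying_at_0 :: "(real \<Rightarrow> real) \<Rightarrow> real \<Rightarrow> bool" where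
  "regularly_varying_at_0 f \<gamma> \<longleftrightarrow>
     (\<forall>t>0. ((\<lambda>\<epsilon>. f (\<epsilon> * t) / f \<epsilon>) \<longlongrightarrow> t powr \<gamma>) (at_right 0))"

end

theory Submission
  imports Defs
begin

text \<open>
  For a Gaussian law \<open>N(0, v)\<close> the tail beyond \<open>r\<close> behaves like \<open>exp (- r\<^sup>2 / (2 v))\<close>. Comparing
  this with the LDP bounds on the sets \<open>{\<phi> \<ge> r}\<close> and \<open>{\<phi> > r}\<close>, for a continuous linear functional
  \<open>\<phi>\<close> with variance \<open>v \<epsilon>\<close>, shows that \<open>g \<epsilon> * v \<epsilon>\<close> cannot have two distinct cluster points;
  compactness of a level set of the rate function keeps it bounded. Polarisation of \<open>x t + x s\<close>
  gives the limit covariance \<open>K\<close>. The ratio \<open>g \<epsilon> / g (\<epsilon> s)\<close> then converges to \<open>K s s / K 1 1\<close>, which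
  is therefore multiplicative in \<open>s\<close>; being continuous on \<open>[0, 1]\<close> and zero at \<open>0\<close>, it is a power
  with positive exponent, and rescaling \<open>\<epsilon>\<close> yields homogeneity.
\<close>

section \<open>Gaussian tails and moments\<close>

text \<open>On \<open>x \<ge> r\<close> the centered density is at most \<open>?c\<close> times the
  density with mean \<open>r\<close>, because
  \<open>r\<^sup>2 + (x - r)\<^sup>2 \<le> x\<^sup>2\<close>, and the latter density has mass
  1.\<close>

lemma (in prob_space) centered_normal_prob_ge_le:
  assumes Y: "distributed M lborel Y (normal_density 0 \<sigma>)" and \<sigma>: "0 < \<sigma>" and r: "0 \<le> r"
  shows "prob {\<omega> \<in> space M. r \<le> Y \<omega>} \<le> exp (- (r\<^sup>2 / (2 * \<sigma>\<^sup>2)))"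
proof -
  interpret N: prob_space "density lborel (normal_density r \<sigma>)"
    by (rule prob_space_normal_density[OF \<sigma>])
  let ?c = "exp (- (r\<^sup>2 / (2 * \<sigma>\<^sup>2)))"
  have le: "normal_density 0 \<sigma> x \<le> ?c * normal_density r \<sigma> x" if "r \<le> x" for x
  proof -
    have "0 \<le> 2 * r * (x - r)" using that r by simp
    then have "r\<^sup>2 + (x - r)\<^sup>2 \<le> x\<^sup>2"
      by (simp add: power2_eq_square algebra_simps)
    then have "(r\<^sup>2 + (x - r)\<^sup>2) / (2 * \<sigma>\<^sup>2) \<le> x\<^sup>2 / (2 * \<sigma>\<^sup>2)"
      by (intro divide_right_mono) auto
    then have "exp (- (x\<^sup>2 / (2 * \<sigma>\<^sup>2))) \<le> ?c * exp (- ((x - r)\<^sup>2 / (2 * \<sigma>\<^sup>2)))"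
      by (simp add: add_divide_distrib flip: exp_add)
    then show ?thesis
      using \<sigma> by (simp add: normal_density_def divide_right_mono)
  qed
  have "emeasure M (Y -` {r..} \<inter> space M) = (\<integral>\<^sup>+x. ennreal (normal_density 0 \<sigma> x) * indicator {r..} x \<partial>lborel)"
    using Y by (rule distributed_emeasure) simp
  also have "\<dots> \<le> (\<integral>\<^sup>+x. ennreal ?c * ennreal (normal_density r \<sigma> x) \<partial>lborel)"
    using le by (intro nn_integral_mono) (auto split: split_indicator simp flip: ennreal_mult)
  also have "\<dots> = ennreal ?c * emeasure (density lborel (normal_density r \<sigma>)) UNIV"
    by (simp add: nn_integral_cmult emeasure_density)
  also have "\<dots> = ennreal ?c"
    using N.emeasure_space_1 by simp
  finally have "emeasure M (Y -` {r..} \<inter> space M) \<le> ennreal ?c" .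
  moreover have "Y -` {r..} \<inter> space M = {\<omega> \<in> space M. r \<le> Y \<omega>}" by auto
  ultimately show ?thesis
    by (simp add: emeasure_eq_measure)
qed

text \<open>Keep only the window \<open>{r<..r + \<sigma>}\<close> and bound the density there by
  its value at the right end. The window length cancels the \<sigma> in the normalisation, so the
  prefactor does not depend on the variance.\<close>

lemma (in prob_space) centered_normal_prob_gt_ge:
  assumes Y: "distributed M lborel Y (normal_density 0 \<sigma>)" and \<sigma>: "0 < \<sigma>" and r: "0 \<le> r"
  shows "exp (- ((r + \<sigma>)\<^sup>2 / (2 * \<sigma>\<^sup>2))) / sqrt (2 * pi) \<le> prob {\<omega> \<in> space M. r < Y \<omega>}"
proof -
  let ?c = "exp (- ((r + \<sigma>)\<^sup>2 / (2 * \<sigma>\<^sup>2)))"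
  have le: "?c / sqrt (2 * pi * \<sigma>\<^sup>2) \<le> normal_density 0 \<sigma> x" if "r < x" "x \<le> r + \<sigma>" for x
  proof -
    have "x\<^sup>2 \<le> (r + \<sigma>)\<^sup>2" using that r by (intro power_mono) auto
    then have "?c \<le> exp (- (x\<^sup>2 / (2 * \<sigma>\<^sup>2)))"
      using \<sigma> by (simp add: divide_right_mono)
    then show ?thesis
      using \<sigma> by (simp add: normal_density_def divide_right_mono)
  qed
  have "ennreal (?c / sqrt (2 * pi)) = ennreal (?c / sqrt (2 * pi * \<sigma>\<^sup>2)) * ennreal \<sigma>"
    using \<sigma> by (simp add: real_sqrt_mult flip: ennreal_mult)
  also have "\<dots> = (\<integral>\<^sup>+x. ennreal (?c / sqrt (2 * pi * \<sigma>\<^sup>2)) * indicator {r<..r + \<sigma>} x \<partial>lborel)"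
    using \<sigma> by (subst nn_integral_cmult_indicator) auto
  also have "\<dots> \<le> (\<integral>\<^sup>+x. ennreal (normal_density 0 \<sigma> x) * indicator {r<..} x \<partial>lborel)"
    using le by (intro nn_integral_mono) (auto split: split_indicator intro!: ennreal_leI)
  also have "\<dots> = emeasure M (Y -` {r<..} \<inter> space M)"
    using Y by (rule distributed_emeasure[symmetric]) simp
  also have "Y -` {r<..} \<inter> space M = {\<omega> \<in> space M. r < Y \<omega>}" by auto
  finally show ?thesis
    by (simp add: emeasure_eq_measure)
qed

lemma (in prob_space) gaussian_rv_square_integrable:
  assumes "gaussian_rv M Y"
  shows "integrable M (\<lambda>\<omega>. (Y \<omega>)\<^sup>2)"
proof -
  have [measurable]: "Y \<in> borel_measurable M"
    using assms by (simp add: gaussian_rv_def)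
  consider m where "AE \<omega> in M. Y \<omega> = m"
    | m \<sigma> where "0 < \<sigma>" "distributed M lborel Y (normal_density m \<sigma>)"
    using assms by (auto simp: gaussian_rv_def)
  then show ?thesis
  proof cases
    case 1
    then have "AE \<omega> in M. (Y \<omega>)\<^sup>2 = m\<^sup>2" by auto
    then show ?thesis
      by (subst integrable_cong_AE[where g="\<lambda>_. m\<^sup>2"]) auto
  next
    case 2
    have eq: "normal_density m \<sigma> x * x\<^sup>2 =
        normal_density m \<sigma> x * (x - m)^2 + 2 * m * (normal_density m \<sigma> x * x) - m\<^sup>2 * normal_density m \<sigma> x" for x
      by (simp add: power2_eq_square algebra_simps)
    have "integrable lborel (\<lambda>x. normal_density m \<sigma> x * x\<^sup>2)"
      unfolding eq using 2(1)
      by (intro Bochner_Integration.integrable_diff Bochner_Integration.integrable_add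
          integrable_mult_right integrable_normal_moment integrable_normal_moment_nz_1 integrable_normal_density)
    then show ?thesis
      using distributed_integrable[OF 2(2), of "\<lambda>x. x\<^sup>2"] by simp
  qed
qed

text \<open>Mean zero forces \<open>m = 0\<close> in both clauses, so that the law is determined by
  the second moment alone.\<close>

lemma (in prob_space) centered_gaussian_rv_cases:
  assumes "gaussian_rv M Y" and "expectation Y = 0"
  obtains (degenerate) "AE \<omega> in M. Y \<omega> = 0" "expectation (\<lambda>\<omega>. (Y \<omega>)\<^sup>2) = 0"
    | (normal) "0 < expectation (\<lambda>\<omega>. (Y \<omega>)\<^sup>2)"
        "distributed M lborel Y (normal_density 0 (sqrt (expectation (\<lambda>\<omega>. (Y \<omega>)\<^sup>2))))"
proof -
  have [measurable]: "Y \<in> borel_measurable M"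
    using assms by (simp add: gaussian_rv_def)
  consider m where "AE \<omega> in M. Y \<omega> = m"
    | m \<sigma> where "0 < \<sigma>" "distributed M lborel Y (normal_density m \<sigma>)"
    using assms by (auto simp: gaussian_rv_def)
  then show thesis
  proof cases
    case 1
    then have "expectation Y = expectation (\<lambda>_. m)"
      by (intro integral_cong_AE) auto
    with assms 1 have ae: "AE \<omega> in M. Y \<omega> = 0" by (simp add: prob_space)
    then have "expectation (\<lambda>\<omega>. (Y \<omega>)\<^sup>2) = expectation (\<lambda>_. 0)"
      by (intro integral_cong_AE) auto
    with ae show thesis by (intro degenerate) auto
  next
    case 2
    have m: "m = 0"
      using normal_distributed_expectation[OF 2] assms(2) by simp
    have "expectation (\<lambda>\<omega>. (Y \<omega>)\<^sup>2) = \<sigma>\<^sup>2"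
      using normal_distributed_variance[OF 2] assms(2) by simp
    with 2 m show thesis by (intro normal) auto
  qed
qed

section \<open>Large deviation bounds\<close>

text \<open>The strict gap between \<open>c\<close> and the infimum turns the limsup bound into an
  eventual one.\<close>

lemma satisfies_LDP_closedD:
  assumes LDP: "satisfies_LDP E \<mu> g I" and F: "closedin E F" and c: "ereal c < (INF x\<in>F. I x)"
  shows "\<forall>\<^sub>F \<epsilon> in at_right 0. measure (\<mu> \<epsilon>) F \<le> exp (- (c * g \<epsilon>))"
proof -
  let ?L = "\<lambda>\<epsilon>. ereal (1 / g \<epsilon>) * log_prob (measure (\<mu> \<epsilon>) F)"
  have "Limsup (at_right 0) ?L \<le> - (INF x\<in>F. I x)"
    using LDP F by (simp add: satisfies_LDP_def)
  also have "\<dots> < - ereal c"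
    using c by (simp only: ereal_minus_less_minus)
  finally have "\<forall>\<^sub>F \<epsilon> in at_right 0. ?L \<epsilon> < - ereal c"
    by (rule Limsup_lessD)
  then show ?thesis
    using eventually_at_right_less[of 0]
  proof eventually_elim
    case (elim \<epsilon>)
    then have g: "0 < g \<epsilon>"
      using LDP by (simp add: satisfies_LDP_def speed_function_def)
    show ?case
    proof (cases "measure (\<mu> \<epsilon>) F = 0")
      case False
      with elim g have "ln (measure (\<mu> \<epsilon>) F) < - (c * g \<epsilon>)"
        by (simp add: log_prob_def field_simps)
      from exp_less_mono[OF this] False show ?thesis
        by (simp add: exp_ln zero_less_measure_iff)
    qed simp
  qed
qed

lemma satisfies_LDP_openD:
  assumes LDP: "satisfies_LDP E \<mu> g I" and G: "openin E G" and c: "(INF x\<in>G. I x) < ereal c"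
  shows "\<forall>\<^sub>F \<epsilon> in at_right 0. exp (- (c * g \<epsilon>)) \<le> measure (\<mu> \<epsilon>) G"
proof -
  let ?L = "\<lambda>\<epsilon>. ereal (1 / g \<epsilon>) * log_prob (measure (\<mu> \<epsilon>) G)"
  have "- ereal c < - (INF x\<in>G. I x)"
    using c by (simp only: ereal_minus_less_minus)
  also have "\<dots> \<le> Liminf (at_right 0) ?L"
    using LDP G by (simp add: satisfies_LDP_def)
  finally have "\<forall>\<^sub>F \<epsilon> in at_right 0. - ereal c < ?L \<epsilon>"
    by (rule less_LiminfD)
  then show ?thesis
    using eventually_at_right_less[of 0]
  proof eventually_elim
    case (elim \<epsilon>)
    then have g: "0 < g \<epsilon>"
      using LDP by (simp add: satisfies_LDP_def speed_function_def)
    show ?case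
    proof (cases "measure (\<mu> \<epsilon>) G = 0")
      case True
      \<comment> \<open>\<open>log_prob\<close> is -\<infinity> here, and so is its product with a
        positive factor, against the strict lower bound.\<close>
      with elim g show ?thesis by (simp add: log_prob_def)
    next
      case False
      with elim g have "- (c * g \<epsilon>) < ln (measure (\<mu> \<epsilon>) G)"
        by (simp add: log_prob_def field_simps)
      from exp_less_mono[OF this] False show ?thesis
        by (simp add: exp_ln zero_less_measure_iff)
    qed
  qed
qed

lemma openin_sets_borel_of_topology: "openin E U \<Longrightarrow> U \<in> sets (borel_of_topology E)"
  unfolding borel_of_topology_def
  by (subst sets_measure_of) (auto dest: openin_subset intro!: sigma_sets.Basic)

section \<open>Compact sets of continuous paths\<close>

text \<open>Evaluation at a point is 1-Lipschitz for the supremum metric.\<close>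

lemma C01_eval_continuous:
  assumes "t \<in> {0..1}"
  shows "continuous_map C01 euclideanreal (\<lambda>x. x t)"
proof -
  have "Lipschitz_continuous_map (cfunspace (top_of_set {0..1::real}) (euclidean_metric :: real metric))
    euclidean_metric (\<lambda>x. x t)"
    unfolding Lipschitz_continuous_map_def
  proof (intro conjI exI[of _ 1] ballI)
    fix x y assume "x \<in> mspace (cfunspace (top_of_set {0..1::real}) (euclidean_metric :: real metric))"
      and "y \<in> mspace (cfunspace (top_of_set {0..1::real}) (euclidean_metric :: real metric))"
    then show "mdist euclidean_metric (x t) (y t)
      \<le> 1 * mdist (cfunspace (top_of_set {0..1}) euclidean_metric) x y"
      using assms mdist_cfunspace_imp_mdist_le[OF _ _ order.refl, of x "top_of_set {0..1}" euclidean_metric y t]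
      by (simp only: mult_1 topspace_euclidean_subtopology)
  qed auto
  from Lipschitz_continuous_imp_continuous_map[OF this] show ?thesis by simp
qed

lemma topspace_C01_continuous_on:
  "x \<in> topspace C01 \<Longrightarrow> continuous_on {0..1} x"
  by (simp add: continuous_map_iff_continuous)

text \<open>The easy half of Arzela-Ascoli, at one point \<open>s\<close>: total boundedness gives a
  finite \<open>\<eta> / 3\<close>-net of continuous paths, whose moduli at \<open>s\<close> have a
  common positive minimum.\<close>

lemma compactin_C01_equicontinuous:
  assumes K: "compactin C01 K" and \<eta>: "0 < \<eta>" and s: "s \<in> {0..1}"
  obtains \<delta> where "0 < \<delta>" "\<And>x t. x \<in> K \<Longrightarrow> t \<in> {0..1} \<Longrightarrow> \<bar>t - s\<bar> < \<delta> \<Longrightarrow> \<bar>x t - x s\<bar> < \<eta>"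
proof -
  let ?m = "cfunspace (top_of_set {0..1::real}) (euclidean_metric :: real metric)"
  interpret S: Metric_space "mspace ?m" "mdist ?m" by (rule Metric_space_mspace_mdist)
  have "S.mtotally_bounded K"
    using K by (intro S.compactin_imp_mtotally_bounded) (simp add: mtopology_of_def)
  then obtain T where T: "finite T" "T \<subseteq> K" "K \<subseteq> (\<Union>y\<in>T. S.mball y (\<eta> / 3))"
    using \<eta> unfolding S.mtotally_bounded_def by (metis divide_pos_pos zero_less_numeral)
  have KE: "K \<subseteq> mspace ?m"
    using compactin_subset_topspace[OF K] by (simp only: topspace_mtopology_of)
  have "\<exists>\<delta>>0. \<forall>t\<in>{0..1}. \<bar>t - s\<bar> < \<delta> \<longrightarrow> \<bar>y t - y s\<bar> < \<eta> / 3" if "y \<in> T" for y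
  proof -
    have "y \<in> topspace C01" using that T(2) KE by (simp only: topspace_mtopology_of) blast
    then have "continuous_on {0..1} y" by (rule topspace_C01_continuous_on)
    from this[unfolded continuous_on_iff, rule_format, OF s, of "\<eta> / 3"] \<eta>
    show ?thesis by (auto simp: dist_real_def)
  qed
  then obtain d where d: "\<And>y. y \<in> T \<Longrightarrow> 0 < d y"
    "\<And>y t. y \<in> T \<Longrightarrow> t \<in> {0..1} \<Longrightarrow> \<bar>t - s\<bar> < d y \<Longrightarrow> \<bar>y t - y s\<bar> < \<eta> / 3"
    using bchoice[of T "\<lambda>y \<delta>. \<delta> > 0 \<and> (\<forall>t\<in>{0..1}. \<bar>t - s\<bar> < \<delta> \<longrightarrow> \<bar>y t - y s\<bar> < \<eta> / 3)"] by blast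
  \<comment> \<open>The inserted 1 keeps \<open>Min\<close> meaningful when the net \<open>T\<close>
    is empty.\<close>
  define \<delta> where "\<delta> = Min (insert 1 (d ` T))"
  show thesis
  proof
    show "0 < \<delta>" using T d by (auto simp: \<delta>_def)
    fix x t assume x: "x \<in> K" and t: "t \<in> {0..1}" "\<bar>t - s\<bar> < \<delta>"
    then obtain y where y: "y \<in> T" "x \<in> S.mball y (\<eta> / 3)"
      using T(3) by blast
    have near: "\<bar>y u - x u\<bar> \<le> \<eta> / 3" if "u \<in> {0..1}" for u
    proof -
      have "dist (y u) (x u) \<le> \<eta> / 3"
        using y that mdist_cfunspace_imp_mdist_le[of y "top_of_set {0..1}" euclidean_metric x "\<eta> / 3" u]
        by (simp del: mspace_cfunspace)
      then show ?thesis by (simp add: dist_real_def)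
    qed
    have "\<delta> \<le> d y" using T y by (auto simp: \<delta>_def)
    then have "\<bar>y t - y s\<bar> < \<eta> / 3"
      using d(2)[OF y(1) t(1)] t by simp
    with near[OF t(1)] near[OF s] show "\<bar>x t - x s\<bar> < \<eta>" by linarith
  qed
qed

section \<open>Limits and power functions\<close>

lemma eventually_at_right_unit: "\<forall>\<^sub>F \<epsilon> in at_right 0. \<epsilon> \<in> {0<..1::real}"
  by (auto simp: eventually_at_right_field intro!: exI[of _ 1])

text \<open>The limit is the infimum of the positive levels that bound \<open>h\<close>
  asymptotically from above: a positive level below that infimum fails the first alternative, hence
  satisfies the second.\<close>

lemma tendsto_of_dichotomy:
  fixes h :: "'b \<Rightarrow> real"
  assumes nonneg: "\<forall>\<^sub>F x in F. 0 \<le> h x" and bdd: "\<forall>\<^sub>F x in F. h x \<le> B"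
    and dich: "\<And>L. 0 < L \<Longrightarrow> (\<forall>y>L. \<forall>\<^sub>F x in F. h x \<le> y) \<or> (\<forall>y<L. \<forall>\<^sub>F x in F. y \<le> h x)"
  obtains l where "(h \<longlongrightarrow> l) F"
proof -
  define S where "S = {L. 0 < L \<and> (\<forall>y>L. \<forall>\<^sub>F x in F. h x \<le> y)}"
  \<comment> \<open>Levels in \<open>S\<close> have to be positive, whereas \<open>B\<close> may not
    be.\<close>
  have "max B 1 \<in> S"
    using bdd by (auto simp: S_def elim!: eventually_mono)
  then have ne: "S \<noteq> {}" by auto
  have bb: "bdd_below S"
    by (intro bdd_belowI[of _ 0]) (auto simp: S_def)
  have "(h \<longlongrightarrow> Inf S) F"
  proof (rule order_tendstoI)
    fix y assume y: "y < Inf S"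
    show "\<forall>\<^sub>F x in F. y < h x"
    proof (cases "y < 0")
      case True
      then show ?thesis using nonneg by (auto elim!: eventually_mono)
    next
      case False
      obtain L where L: "y < L" "L < Inf S" using dense y by blast
      obtain z where z: "y < z" "z < L" using dense L by blast
      have "L \<notin> S" using L cInf_lower[OF _ bb] by force
      with dich[of L] L z False have "\<forall>\<^sub>F x in F. z \<le> h x" by (auto simp: S_def)
      with z show ?thesis by (auto elim!: eventually_mono)
    qed
  next
    fix y assume "Inf S < y"
    then obtain L where L: "L \<in> S" "L < y" using cInf_lessD[OF ne] by blast
    obtain z where z: "L < z" "z < y" using dense L by blast
    with L have "\<forall>\<^sub>F x in F. h x \<le> z" by (auto simp: S_def)
    with z show "\<forall>\<^sub>F x in F. h x < y" by (auto elim!: eventually_mono)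
  qed
  then show thesis by (rule that)
qed

text \<open>Additivity and nonnegativity give monotonicity. Placing \<open>n * u\<close> between
  consecutive integers then bounds \<open>n * \<bar>G u - u * G 1\<bar>\<close> by
  \<open>G 1\<close> for every \<open>n\<close>.\<close>

lemma additive_nonneg_imp_linear:
  fixes G :: "real \<Rightarrow> real"
  assumes add: "\<And>u v. 0 \<le> u \<Longrightarrow> 0 \<le> v \<Longrightarrow> G (u + v) = G u + G v"
    and nonneg: "\<And>u. 0 \<le> u \<Longrightarrow> 0 \<le> G u" and u: "0 \<le> u"
  shows "G u = u * G 1"
proof -
  have mult: "G (real n * v) = real n * G v" if "0 \<le> v" for n v
  proof (induction n)
    case 0 then show ?case using add[of 0 0] by simp
  next
    case (Suc n)
    then show ?case using add[of v "real n * v"] that by (simp add: algebra_simps)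
  qed
  have mono: "G v \<le> G w" if "0 \<le> v" "v \<le> w" for v w
    using add[of v "w - v"] nonneg[of "w - v"] that by simp
  have G1: "0 \<le> G 1" using nonneg by simp
  have bound: "real n * \<bar>G u - u * G 1\<bar> \<le> G 1" for n
  proof -
    define m where "m = nat \<lfloor>real n * u\<rfloor>"
    have m: "real m \<le> real n * u" "real n * u \<le> real (Suc m)"
      using u by (auto simp: m_def) linarith+
    have "real m * G 1 \<le> real n * G u" "real n * G u \<le> real (Suc m) * G 1"
      using mono[OF _ m(1)] mono[OF _ m(2)] mult[of 1 m] mult[of 1 "Suc m"] mult[OF u, of n] u
      by auto
    moreover have "real m * G 1 \<le> (real n * u) * G 1" "(real n * u) * G 1 \<le> real (Suc m) * G 1"
      using m G1 by (auto intro: mult_right_mono)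
    ultimately have "\<bar>real n * G u - real n * u * G 1\<bar> \<le> G 1"
      by (simp add: algebra_simps)
    moreover have "real n * G u - real n * u * G 1 = real n * (G u - u * G 1)"
      by (simp add: algebra_simps)
    ultimately show ?thesis by (simp add: abs_mult)
  qed
  have "\<bar>G u - u * G 1\<bar> \<le> 0"
  proof (rule ccontr)
    assume "\<not> ?thesis"
    then obtain n where "G 1 < real n * \<bar>G u - u * G 1\<bar>"
      using reals_Archimedean3[of "\<bar>G u - u * G 1\<bar>"] by auto
    with bound[of n] show False by simp
  qed
  then show ?thesis by simp
qed

text \<open>In the variable \<open>u = - ln t\<close> the function \<open>- ln (F t)\<close> is
  additive, hence linear. The limit at 1 makes \<open>F\<close> positive, so that the logarithm
  behaves; the limit at 0 makes \<open>F < 1\<close> on (0,1), so that the exponent is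
  positive.\<close>

lemma multiplicative_imp_powr:
  fixes F :: "real \<Rightarrow> real"
  assumes mult: "\<And>s t. 0 < s \<Longrightarrow> s \<le> 1 \<Longrightarrow> 0 < t \<Longrightarrow> t \<le> 1 \<Longrightarrow> F (s * t) = F s * F t"
    and nonneg: "\<And>t. 0 < t \<Longrightarrow> t \<le> 1 \<Longrightarrow> 0 \<le> F t"
    and one: "(F \<longlongrightarrow> 1) (at_left 1)" and zero: "(F \<longlongrightarrow> 0) (at_right 0)"
  obtains \<beta> where "0 < \<beta>" "\<And>t. 0 < t \<Longrightarrow> t < 1 \<Longrightarrow> F t = t powr \<beta>"
proof -
  have pow: "F (t ^ Suc n) = F t ^ Suc n" if "0 < t" "t \<le> 1" for t n
  proof (induction n)
    case (Suc n)
    then show ?case using mult[of t "t ^ Suc n"] that power_le_one[of t "Suc n"] by simp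
  qed simp
  have pos: "0 < F t" if t: "0 < t" "t < 1" for t
  proof -
    have "\<forall>\<^sub>F s in at_left 1. 0 < F s" using one by (rule order_tendstoD) simp
    then obtain b where b: "b < 1" "\<And>s. b < s \<Longrightarrow> s < 1 \<Longrightarrow> 0 < F s"
      by (auto simp: eventually_at_left_field)
    \<comment> \<open>High roots of \<open>t\<close> come close to 1, where \<open>F\<close> is
      positive, and \<open>F t\<close> is a power of \<open>F\<close> at such a root.\<close>
    have "(\<lambda>n. root (Suc n) t) \<longlonglongrightarrow> 1"
      using LIMSEQ_root_const[OF t(1)] by (rule LIMSEQ_Suc)
    then obtain n where n: "b < root (Suc n) t"
      using order_tendstoD(1)[of _ 1 sequentially b] b(1)
      by (metis (mono_tags, lifting) eventually_sequentially order_refl)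
    have r: "0 < root (Suc n) t" "root (Suc n) t < 1"
      using t by auto
    have "F t = F (root (Suc n) t) ^ Suc n"
      using pow[of "root (Suc n) t" n] r t by (simp del: power_Suc)
    with b(2)[OF n r(2)] show ?thesis by simp
  qed
  have less: "F t < 1" if t: "0 < t" "t < 1" for t
  proof (rule ccontr)
    assume "\<not> F t < 1"
    then have ge: "1 \<le> F (t ^ Suc n)" for n
      unfolding pow[OF t(1) less_imp_le[OF t(2)]] by (intro one_le_power) simp
    have "(\<lambda>n. t ^ Suc n) \<longlonglongrightarrow> 0"
      using t by (intro LIMSEQ_Suc LIMSEQ_realpow_zero) auto
    then have "filterlim (\<lambda>n. t ^ Suc n) (at_right 0) sequentially"
      using t by (intro tendsto_imp_filterlim_at_right) auto
    then have "(\<lambda>n. F (t ^ Suc n)) \<longlonglongrightarrow> 0"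
      using zero by (rule filterlim_compose[rotated])
    then have "1 \<le> (0::real)"
      by (rule LIMSEQ_le_const) (use ge in auto)
    then show False by simp
  qed
  have "F 1 = F 1 * F 1" using mult[of 1 1] by simp
  \<comment> \<open>\<open>F 1 = 0\<close> would make \<open>F (1/2) = F 1 * F (1/2)\<close>
    vanish.\<close>
  moreover have "F 1 \<noteq> 0" using mult[of 1 "1/2"] pos[of "1/2"] by auto
  ultimately have F1: "F 1 = 1" by simp
  define G where "G u = - ln (F (exp (- u)))" for u
  have Fpos: "0 < F (exp (- u))" if "0 \<le> u" for u
    using pos[of "exp (- u)"] F1 that by (cases "u = 0") auto
  have lin: "G u = u * G 1" if "0 \<le> u" for u
  proof (rule additive_nonneg_imp_linear)
    fix u v :: real assume "0 \<le> u" "0 \<le> v"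
    then show "G (u + v) = G u + G v"
      using mult[of "exp (- u)" "exp (- v)"] Fpos[of u] Fpos[of v]
      by (simp add: G_def exp_diff exp_minus field_simps ln_mult_pos)
  next
    fix u :: real assume "0 \<le> u"
    then show "0 \<le> G u"
      using less[of "exp (- u)"] F1 Fpos[of u] by (cases "u = 0") (auto simp: G_def)
  qed (rule that)
  show thesis
  proof
    show "0 < G 1"
      using less[of "exp (- 1)"] Fpos[of 1] by (simp add: G_def)
    fix t :: real assume t: "0 < t" "t < 1"
    then have "- ln (F t) = - ln t * G 1"
      using lin[of "- ln t"] by (simp add: G_def)
    then have "exp (ln (F t)) = exp (G 1 * ln t)" by simp
    then show "F t = t powr G 1"
      using t pos[OF t] by (simp add: powr_def)
  qed
qed

section \<open>Scaled variance of a Gaussian functional\<close>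

text \<open>A single real functional, detached from path space, so that the estimates apply to any
  combination of path values. The conditions are limited to \<epsilon> in (0,1], where
  \<open>\<epsilon> * t\<close> stays in [0,1] for all \<open>t\<close> in [0,1].\<close>

locale gaussian_functional_LDP =
  fixes E :: "'b topology" and \<mu> :: "real \<Rightarrow> 'b measure" and g :: "real \<Rightarrow> real"
    and I :: "'b \<Rightarrow> ereal" and \<phi> :: "'b \<Rightarrow> real" and v :: "real \<Rightarrow> real"
  assumes LDP: "satisfies_LDP E \<mu> g I"
    and prob_space: "\<epsilon> \<in> {0<..1} \<Longrightarrow> prob_space (\<mu> \<epsilon>)"
    and space: "\<epsilon> \<in> {0<..1} \<Longrightarrow> space (\<mu> \<epsilon>) = topspace E"
    and continuous: "continuous_map E euclideanreal \<phi>"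
    and gaussian: "\<epsilon> \<in> {0<..1} \<Longrightarrow> gaussian_rv (\<mu> \<epsilon>) \<phi>"
    and centered: "\<epsilon> \<in> {0<..1} \<Longrightarrow> integral\<^sup>L (\<mu> \<epsilon>) \<phi> = 0"
    and v: "\<epsilon> \<in> {0<..1} \<Longrightarrow> v \<epsilon> = integral\<^sup>L (\<mu> \<epsilon>) (\<lambda>x. (\<phi> x)\<^sup>2)"
begin

section \<open>Tail estimates for the functional\<close>

lemma v_nonneg: "\<epsilon> \<in> {0<..1} \<Longrightarrow> 0 \<le> v \<epsilon>"
  by (simp add: v)

lemma g_pos: "\<epsilon> \<in> {0<..1} \<Longrightarrow> 0 < g \<epsilon>"
  using LDP by (simp add: satisfies_LDP_def speed_function_def)

lemma g_at_top: "filterlim g at_top (at_right 0)"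
  using LDP by (simp add: satisfies_LDP_def speed_function_def)

lemma \<phi>_borel: "\<epsilon> \<in> {0<..1} \<Longrightarrow> \<phi> \<in> borel_measurable (\<mu> \<epsilon>)"
  using gaussian by (simp add: gaussian_rv_def)

lemma prob_gt_le_prob_ge:
  assumes "\<epsilon> \<in> {0<..1}" and "r \<le> r'"
  shows "measure (\<mu> \<epsilon>) {x \<in> topspace E. r' < \<phi> x} \<le> measure (\<mu> \<epsilon>) {x \<in> topspace E. r \<le> \<phi> x}"
proof -
  interpret prob_space "\<mu> \<epsilon>" using assms by (intro prob_space)
  note [measurable] = \<phi>_borel[OF assms(1)]
  show ?thesis
    unfolding space[OF assms(1), symmetric] using assms(2) by (intro finite_measure_mono) auto
qed

text \<open>The degenerate case is split off because division by 0 yields 0 and would turn the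
  exponential into the useless bound 1; there \<open>0 < r\<close> makes the event null.\<close>

lemma prob_ge_le:
  assumes \<epsilon>: "\<epsilon> \<in> {0<..1}" and r: "0 < r"
  shows "measure (\<mu> \<epsilon>) {x \<in> topspace E. r \<le> \<phi> x} \<le> (if v \<epsilon> = 0 then 0 else exp (- (r\<^sup>2 / (2 * v \<epsilon>))))"
proof -
  interpret prob_space "\<mu> \<epsilon>" using \<epsilon> by (rule prob_space)
  from gaussian[OF \<epsilon>] centered[OF \<epsilon>] show ?thesis
  proof (cases rule: centered_gaussian_rv_cases)
    case degenerate
    then have "AE x in \<mu> \<epsilon>. x \<notin> {x \<in> topspace E. r \<le> \<phi> x}" using r by auto
    then have "prob {x \<in> topspace E. r \<le> \<phi> x} = 0"
      using \<phi>_borel[OF \<epsilon>] by (subst prob_eq_0) (auto simp flip: space[OF \<epsilon>])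
    with degenerate \<epsilon> show ?thesis by (simp add: v)
  next
    case normal
    then show ?thesis
      using centered_normal_prob_ge_le[OF normal(2), of r] r \<epsilon> by (simp add: v space)
  qed
qed

lemma prob_gt_ge:
  assumes \<epsilon>: "\<epsilon> \<in> {0<..1}" and r: "0 < r" and pos: "0 < v \<epsilon>"
  shows "exp (- ((r + sqrt (v \<epsilon>))\<^sup>2 / (2 * v \<epsilon>))) / sqrt (2 * pi)
    \<le> measure (\<mu> \<epsilon>) {x \<in> topspace E. r < \<phi> x}"
proof -
  interpret prob_space "\<mu> \<epsilon>" using \<epsilon> by (rule prob_space)
  from gaussian[OF \<epsilon>] centered[OF \<epsilon>] show ?thesis
  proof (cases rule: centered_gaussian_rv_cases)
    case degenerate
    with pos \<epsilon> show ?thesis by (simp add: v)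
  next
    case normal
    then show ?thesis
      using centered_normal_prob_gt_ge[OF normal(2), of r] r \<epsilon> by (simp add: v space)
  qed
qed

lemma openin_gt: "openin E {x \<in> topspace E. r < \<phi> x}"
  using openin_continuous_map_preimage[OF continuous, of "{r<..}"] by simp

lemma closedin_ge: "closedin E {x \<in> topspace E. r \<le> \<phi> x}"
  using closedin_continuous_map_preimage[OF continuous, of "{r..}"] by simp

text \<open>Gaussian lower tail against LDP upper bound. With
  \<open>s\<^sup>2 = v \<epsilon>\<close> they give
  \<open>c * g \<epsilon> \<le> (r + s)\<^sup>2 / (2 * s\<^sup>2)\<close> up to a constant; Young's
  inequality absorbs the shift by \<open>s\<close> at the price of enlarging
  \<open>r\<^sup>2 / 2\<close> to \<open>A\<close>.\<close>

lemma eventually_scaled_variance_le: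
  assumes r: "0 < r" and c: "0 < c" and inf: "ereal c < (INF x\<in>{x \<in> topspace E. r \<le> \<phi> x}. I x)"
    and y: "r\<^sup>2 / (2 * c) < y"
  shows "\<forall>\<^sub>F \<epsilon> in at_right 0. g \<epsilon> * v \<epsilon> \<le> y"
proof -
  have y0: "0 < y" using y c by (intro order.strict_trans1[OF _ y]) simp
  have rcy: "r\<^sup>2 < 2 * c * y" using y c by (simp add: field_simps)
  \<comment> \<open>Chosen so that \<open>A\<close> becomes the midpoint of
    \<open>r\<^sup>2 / 2\<close> and \<open>c * y\<close>, hence lies strictly below
    \<open>c * y\<close>.\<close>
  define \<eta> where "\<eta> = (2 * c * y - r\<^sup>2) / (2 * r\<^sup>2)"
  have \<eta>: "0 < \<eta>" using rcy r by (simp add: \<eta>_def)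
  define A where "A = (1 + \<eta>) * r\<^sup>2 / 2"
  have "A = (2 * c * y + r\<^sup>2) / 4" using r by (simp add: A_def \<eta>_def field_simps)
  with rcy have A: "A < c * y" by simp
  \<comment> \<open>Collects what stays constant: the \<open>s\<^sup>2\<close> term of Young's
    inequality over \<open>2 * s\<^sup>2\<close>, and the contribution of the Gaussian
    prefactor.\<close>
  define C where "C = (1 + 1 / \<eta>) / 2 + ln (sqrt (2 * pi))"
  have "filterlim (\<lambda>\<epsilon>. g \<epsilon> * (c * y - A)) at_top (at_right 0)"
    using A by (intro filterlim_at_top_mult_tendsto_pos[OF tendsto_const _ g_at_top]) auto
  then have "\<forall>\<^sub>F \<epsilon> in at_right 0. C * y \<le> g \<epsilon> * (c * y - A)"
    by (auto simp: filterlim_at_top)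
  moreover have "filterlim (\<lambda>\<epsilon>. g \<epsilon> * c) at_top (at_right 0)"
    using c by (intro filterlim_at_top_mult_tendsto_pos[OF tendsto_const _ g_at_top]) auto
  then have "\<forall>\<^sub>F \<epsilon> in at_right 0. C < g \<epsilon> * c"
    by (auto simp: filterlim_at_top_dense)
  moreover note satisfies_LDP_closedD[OF LDP closedin_ge inf] eventually_at_right_unit
  ultimately show ?thesis
  proof eventually_elim
    case (elim \<epsilon>)
    show ?case
    proof (cases "v \<epsilon> = 0")
      case True
      then show ?thesis using y0 by simp
    next
      case False
      define s where "s = sqrt (v \<epsilon>)"
      have s: "0 < s" "v \<epsilon> = s\<^sup>2" using False v_nonneg[OF elim(4)] by (auto simp: s_def)
      have "0 \<le> (\<eta> * r - s)\<^sup>2" by simp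
      then have "0 \<le> (\<eta> * r - s)\<^sup>2 / \<eta>" using \<eta> by simp
      also have "(\<eta> * r - s)\<^sup>2 / \<eta> = \<eta> * r\<^sup>2 + s\<^sup>2 / \<eta> - 2 * r * s"
        using \<eta> by (simp add: power2_eq_square field_simps)
      finally have "(r + s)\<^sup>2 \<le> (1 + \<eta>) * r\<^sup>2 + (1 + 1 / \<eta>) * s\<^sup>2"
        by (simp add: power2_eq_square algebra_simps)
      then have young: "(r + s)\<^sup>2 \<le> 2 * A + (1 + 1 / \<eta>) * s\<^sup>2"
        by (simp add: A_def)
      have "exp (- ((r + s)\<^sup>2 / (2 * s\<^sup>2))) / sqrt (2 * pi) \<le> exp (- (c * g \<epsilon>))"
        using prob_gt_ge[OF elim(4) r] prob_gt_le_prob_ge[OF elim(4) order.refl, of r] elim(3)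
        unfolding s(2) using s(1) by simp
      then have "exp (- ((r + s)\<^sup>2 / (2 * s\<^sup>2)) - ln (sqrt (2 * pi))) \<le> exp (- (c * g \<epsilon>))"
        by (simp add: exp_diff)
      then have "c * g \<epsilon> \<le> (r + s)\<^sup>2 / (2 * s\<^sup>2) + ln (sqrt (2 * pi))"
        by simp
      also have "\<dots> \<le> (2 * A + (1 + 1 / \<eta>) * s\<^sup>2) / (2 * s\<^sup>2) + ln (sqrt (2 * pi))"
        using young s by (intro add_right_mono divide_right_mono) auto
      also have "\<dots> = A / s\<^sup>2 + C"
        using s by (simp add: C_def add_divide_distrib)
      finally have "(g \<epsilon> * c - C) * s\<^sup>2 \<le> A"
        using s by (simp add: field_simps)
      \<comment> \<open>Multiplying by \<open>g \<epsilon>\<close> produces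
        \<open>g \<epsilon> * v \<epsilon>\<close> on the left. Since \<open>A < c * y\<close> and
        \<open>g\<close> is large, the right side is at most the same positive factor times
        \<open>y\<close>.\<close>
      then have "(g \<epsilon> * c - C) * s\<^sup>2 * g \<epsilon> \<le> A * g \<epsilon>"
        using g_pos[OF elim(4)] by (intro mult_right_mono) auto
      also have "\<dots> \<le> (g \<epsilon> * c - C) * y"
        using elim(1) by (simp add: algebra_simps)
      finally have "(g \<epsilon> * c - C) * (g \<epsilon> * v \<epsilon>) \<le> (g \<epsilon> * c - C) * y"
        by (simp add: s(2) ac_simps)
      then show ?thesis
        using elim(2) by (simp add: mult_le_cancel_left_pos)
    qed
  qed
qed

text \<open>Gaussian upper tail against LDP lower bound: positivity of the latter excludes
  \<open>v \<epsilon> = 0\<close>, and then the exponents are compared directly.\<close>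

lemma eventually_scaled_variance_ge:
  assumes r: "0 < r" and c: "0 < c" and inf: "(INF x\<in>{x \<in> topspace E. r < \<phi> x}. I x) < ereal c"
  shows "\<forall>\<^sub>F \<epsilon> in at_right 0. r\<^sup>2 / (2 * c) \<le> g \<epsilon> * v \<epsilon>"
  using satisfies_LDP_openD[OF LDP openin_gt inf] eventually_at_right_unit
proof eventually_elim
  case (elim \<epsilon>)
  have *: "exp (- (c * g \<epsilon>)) \<le> (if v \<epsilon> = 0 then 0 else exp (- (r\<^sup>2 / (2 * v \<epsilon>))))"
    using elim(1) prob_gt_le_prob_ge[OF elim(2) order.refl, of r] prob_ge_le[OF elim(2) r] by linarith
  then have "v \<epsilon> \<noteq> 0"
    by (auto simp: not_le)
  then have "0 < v \<epsilon>" using v_nonneg[OF elim(2)] by simp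
  with * c show ?case by (simp add: field_simps)
qed

text \<open>The closed set misses the level set \<open>I \<le> 1\<close>, so the infimum is at least
  1. The value 1/2 leaves a strict gap, and with \<open>c = 1/2\<close> the threshold
  \<open>r\<^sup>2 / (2 * c)\<close> is just \<open>r\<^sup>2\<close>.\<close>

lemma inf_rate_ge:
  assumes "\<And>x. x \<in> topspace E \<Longrightarrow> I x \<le> 1 \<Longrightarrow> \<phi> x < r"
  shows "ereal (1 / 2) < (INF x\<in>{x \<in> topspace E. r \<le> \<phi> x}. I x)"
proof -
  have "ereal (1 / 2) < 1" by simp
  also have "1 \<le> (INF x\<in>{x \<in> topspace E. r \<le> \<phi> x}. I x)"
  proof (rule INF_greatest)
    fix x assume x: "x \<in> {x \<in> topspace E. r \<le> \<phi> x}"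
    then have "\<not> I x \<le> 1" using assms[of x] by auto
    then show "1 \<le> I x" by simp
  qed
  finally show ?thesis .
qed

section \<open>Convergence of the scaled variance\<close>

lemma compactin_level_set: "compactin E {x \<in> topspace E. I x \<le> 1}"
  using LDP by (auto simp: satisfies_LDP_def rate_function_def one_ereal_def)

lemma eventually_scaled_variance_bounded: "\<exists>B. \<forall>\<^sub>F \<epsilon> in at_right 0. g \<epsilon> * v \<epsilon> \<le> B"
proof -
  have "compactin euclideanreal (\<phi> ` {x \<in> topspace E. I x \<le> 1})"
    by (rule image_compactin[OF compactin_level_set continuous])
  then have "bounded (\<phi> ` {x \<in> topspace E. I x \<le> 1})"
    by (auto intro: compact_imp_bounded)
  then obtain R where R: "0 < R" "\<And>x. x \<in> topspace E \<Longrightarrow> I x \<le> 1 \<Longrightarrow> \<bar>\<phi> x\<bar> \<le> R"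
    by (auto simp: bounded_pos)
  have "ereal (1 / 2) < (INF x\<in>{x \<in> topspace E. R + 1 \<le> \<phi> x}. I x)"
    using R by (intro inf_rate_ge) force
  from eventually_scaled_variance_le[OF _ _ this, of "(R + 1)\<^sup>2 + 1"] R
  show ?thesis by auto
qed

text \<open>Each level \<open>L\<close> is tested by whether the infimum of \<open>I\<close> over
  \<open>\<phi> \<ge> 1\<close> exceeds \<open>1 / (2 * L)\<close>: if so, the closed-set bound
  controls the scaled variance from above, otherwise the open-set bound controls it from
  below.\<close>

lemma scaled_variance_tendsto:
  obtains l where "((\<lambda>\<epsilon>. g \<epsilon> * v \<epsilon>) \<longlongrightarrow> l) (at_right 0)"
proof -
  obtain B where B: "\<forall>\<^sub>F \<epsilon> in at_right 0. g \<epsilon> * v \<epsilon> \<le> B"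
    using eventually_scaled_variance_bounded by blast
  have nonneg: "\<forall>\<^sub>F \<epsilon> in at_right 0. 0 \<le> g \<epsilon> * v \<epsilon>"
    using eventually_at_right_unit by eventually_elim (intro mult_nonneg_nonneg v_nonneg less_imp_le[OF g_pos])
  show thesis
  proof (rule tendsto_of_dichotomy[OF nonneg B])
    fix L :: real assume L: "0 < L"
    let ?inf = "INF x\<in>{x \<in> topspace E. 1 \<le> \<phi> x}. I x"
    show "(\<forall>y>L. \<forall>\<^sub>F \<epsilon> in at_right 0. g \<epsilon> * v \<epsilon> \<le> y) \<or> (\<forall>y<L. \<forall>\<^sub>F \<epsilon> in at_right 0. y \<le> g \<epsilon> * v \<epsilon>)"
    proof (cases "ereal (1 / (2 * L)) < ?inf")
      case True
      then show ?thesis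
        using eventually_scaled_variance_le[OF _ _ True] L by simp
    next
      case False
      have "\<forall>\<^sub>F \<epsilon> in at_right 0. y \<le> g \<epsilon> * v \<epsilon>" if y: "y < L" for y
      proof (cases "y \<le> 0")
        case True
        from nonneg show ?thesis by eventually_elim (use True in auto)
      next
        case y0: False
        \<comment> \<open>\<open>r < 1\<close> lets the open set \<open>\<phi> > r\<close> contain
          the closed set \<open>\<phi> \<ge> 1\<close>. As midpoint of \<open>y / L\<close> and 1,
          \<open>r\<^sup>2\<close> exceeds \<open>y / L\<close>, so
          \<open>r\<^sup>2 / (2 * y)\<close> exceeds \<open>1 / (2 * L)\<close>.\<close>
        define r where "r = sqrt ((1 + y / L) / 2)"
        have r: "0 < r" "r < 1" "r\<^sup>2 = (1 + y / L) / 2"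
          using y0 y L by (auto simp: r_def add_pos_pos)
        have "?inf \<le> ereal (1 / (2 * L))" using False by simp
        also have "\<dots> < ereal (r\<^sup>2 / (2 * y))"
          using y y0 L by (simp add: r(3) field_simps)
        finally have "?inf < ereal (r\<^sup>2 / (2 * y))" .
        moreover have "(INF x\<in>{x \<in> topspace E. r < \<phi> x}. I x) \<le> ?inf"
          using r by (intro INF_superset_mono) auto
        ultimately have "(INF x\<in>{x \<in> topspace E. r < \<phi> x}. I x) < ereal (r\<^sup>2 / (2 * y))"
          by (rule order.strict_trans1[rotated])
        moreover have "0 < r\<^sup>2 / (2 * y)" "r\<^sup>2 / (2 * (r\<^sup>2 / (2 * y))) = y"
          using r(1) y0 by auto
        ultimately show ?thesis
          using eventually_scaled_variance_ge[OF r(1), of "r\<^sup>2 / (2 * y)"] by simp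
      qed
      then show ?thesis by blast
    qed
  qed (rule that)
qed

text \<open>Carries a uniform bound on the level set \<open>I \<le> 1\<close> over to the limit
  variance; applied to increments it yields continuity of the limit kernel.\<close>

lemma scaled_variance_limit_le:
  assumes lim: "((\<lambda>\<epsilon>. g \<epsilon> * v \<epsilon>) \<longlongrightarrow> l) (at_right 0)" and r: "0 < r"
    and bound: "\<And>x. x \<in> topspace E \<Longrightarrow> I x \<le> 1 \<Longrightarrow> \<phi> x < r"
  shows "l \<le> r\<^sup>2"
proof (rule dense_ge)
  fix y assume "r\<^sup>2 < y"
  then have "\<forall>\<^sub>F \<epsilon> in at_right 0. g \<epsilon> * v \<epsilon> \<le> y"
    using r by (intro eventually_scaled_variance_le[OF r _ inf_rate_ge[OF bound]]) auto
  with lim show "l \<le> y" by (intro tendsto_upperbound) auto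
qed

text \<open>The open set \<open>\<phi> > \<phi> x / 2\<close> contains \<open>x\<close> and so has
  finite infimum; its probability cannot decay too fast, which keeps the scaled variance away from
  0.\<close>

lemma scaled_variance_limit_pos:
  assumes lim: "((\<lambda>\<epsilon>. g \<epsilon> * v \<epsilon>) \<longlongrightarrow> l) (at_right 0)"
    and x: "x \<in> topspace E" "I x < \<infinity>" "0 < \<phi> x"
  shows "0 < l"
proof -
  have "0 \<le> I x"
    using LDP x by (simp add: satisfies_LDP_def rate_function_def)
  with x obtain i where i: "I x = ereal i" "0 \<le> i"
    by (cases "I x") auto
  have "(INF x\<in>{x \<in> topspace E. \<phi> x / 2 < \<phi> x}. I x) \<le> I x"
    using x by (intro INF_lower) auto
  \<comment> \<open>\<open>i + 1\<close> makes the comparison strict and stays positive when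
    \<open>i = 0\<close>.\<close>
  then have "(INF z\<in>{z \<in> topspace E. \<phi> x / 2 < \<phi> z}. I z) < ereal (i + 1)"
    using x i by (intro order.strict_trans1[OF INF_lower[of x]]) auto
  with x i have "\<forall>\<^sub>F \<epsilon> in at_right 0. (\<phi> x / 2)\<^sup>2 / (2 * (i + 1)) \<le> g \<epsilon> * v \<epsilon>"
    by (intro eventually_scaled_variance_ge) auto
  with lim have "(\<phi> x / 2)\<^sup>2 / (2 * (i + 1)) \<le> l"
    by (intro tendsto_lowerbound) auto
  moreover have "0 < (\<phi> x / 2)\<^sup>2 / (2 * (i + 1))"
    using x i by (intro divide_pos_pos) auto
  ultimately show ?thesis by linarith
qed

end

section \<open>The limit covariance\<close>

lemma filterlim_times_right_at_right_0:
  fixes c :: real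
  assumes "0 < c"
  shows "filterlim (\<lambda>x. x * c) (at_right 0) (at_right 0)"
proof (rule tendsto_imp_filterlim_at_right)
  show "((\<lambda>x. x * c) \<longlongrightarrow> 0) (at_right 0)"
    by (auto intro!: tendsto_eq_intros)
  show "\<forall>\<^sub>F x in at_right 0. 0 < x * c"
    using eventually_at_right_less[of 0] by eventually_elim (use assms in auto)
qed

lemma (in prob_space) gaussian_rv_distr:
  assumes "T \<in> measurable M N" and "f \<in> borel_measurable N"
  shows "gaussian_rv (distr M N T) f \<longleftrightarrow> gaussian_rv M (\<lambda>\<omega>. f (T \<omega>))"
proof -
  note [measurable] = assms
  have AE: "(AE x in distr M N T. f x = m) \<longleftrightarrow> (AE \<omega> in M. f (T \<omega>) = m)" for m
    by (subst AE_distr_iff) auto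
  have "distributed (distr M N T) lborel f h \<longleftrightarrow> distributed M lborel (\<lambda>\<omega>. f (T \<omega>)) h" for h
    unfolding distributed_def by (simp add: distr_distr comp_def)
  with AE show ?thesis
    unfolding gaussian_rv_def by simp
qed

locale small_time_gaussian_LDP = prob_space M
  for M :: "'a measure" +
  fixes X :: "real \<Rightarrow> 'a \<Rightarrow> real" and k :: "real \<Rightarrow> real \<Rightarrow> real"
    and g :: "real \<Rightarrow> real" and I :: "(real \<Rightarrow> real) \<Rightarrow> ereal"
  assumes gaussian_process: "gaussian_process M {0..1} X"
    and centered_process: "centered_process M {0..1} X"
    and k_def: "\<And>t s. t \<in> {0..1} \<Longrightarrow> s \<in> {0..1} \<Longrightarrow> k t s = covariance M (X t) (X s)"
    and small_time_LDP: "small_time_LDP M X g I"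
begin

section \<open>Gaussian combinations and second moments\<close>

lemma gaussian_combination:
  assumes "t \<in> {0..1}" "s \<in> {0..1}"
  shows "gaussian_rv M (\<lambda>\<omega>. a * X t \<omega> + b * X s \<omega>)"
proof -
  have gauss: "gaussian_rv M (\<lambda>\<omega>. \<Sum>u\<in>{t, s}. c u * X u \<omega>)" for c
    using gaussian_process[unfolded gaussian_process_def, rule_format, of "{t, s}" c] assms by simp
  show ?thesis
  proof (cases "t = s")
    case True
    with gauss[of "\<lambda>_. a + b"] show ?thesis by (simp add: algebra_simps)
  next
    case False
    with gauss[of "\<lambda>u. if u = t then a else b"] show ?thesis by simp
  qed
qed

lemma X_gaussian: "t \<in> {0..1} \<Longrightarrow> gaussian_rv M (X t)"
  using gaussian_combination[of t t 1 0] by simp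

lemma X_borel: "t \<in> {0..1} \<Longrightarrow> X t \<in> borel_measurable M"
  using X_gaussian by (simp add: gaussian_rv_def)

lemma X_square_integrable: "t \<in> {0..1} \<Longrightarrow> integrable M (\<lambda>\<omega>. (X t \<omega>)\<^sup>2)"
  using X_gaussian gaussian_rv_square_integrable by blast

lemma X_integrable: "t \<in> {0..1} \<Longrightarrow> integrable M (X t)"
  using square_integrable_imp_integrable[OF X_borel X_square_integrable] by blast

lemma X_centered: "t \<in> {0..1} \<Longrightarrow> expectation (X t) = 0"
  using centered_process by (simp add: centered_process_def)

lemma X_mult_integrable:
  assumes t: "t \<in> {0..1}" and s: "s \<in> {0..1}"
  shows "integrable M (\<lambda>\<omega>. X t \<omega> * X s \<omega>)"
proof -
  note [measurable] = X_borel[OF t] X_borel[OF s]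
  have le: "\<bar>x * y\<bar> \<le> x\<^sup>2 + y\<^sup>2" for x y :: real
    using sum_squares_bound[of x y] sum_squares_bound[of x "- y"] by (auto simp: abs_le_iff)
  show ?thesis
    by (rule Bochner_Integration.integrable_bound[OF Bochner_Integration.integrable_add[OF
        X_square_integrable[OF t] X_square_integrable[OF s]]]) (auto simp: le)
qed

lemma k_eq: "t \<in> {0..1} \<Longrightarrow> s \<in> {0..1} \<Longrightarrow> k t s = expectation (\<lambda>\<omega>. X t \<omega> * X s \<omega>)"
  by (simp add: k_def covariance_def X_centered)

lemma expectation_combination_squared:
  assumes t: "t \<in> {0..1}" and s: "s \<in> {0..1}"
  shows "expectation (\<lambda>\<omega>. (a * X t \<omega> + b * X s \<omega>)\<^sup>2) = a\<^sup>2 * k t t + 2 * a * b * k t s + b\<^sup>2 * k s s"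
proof -
  have "(\<lambda>\<omega>. (a * X t \<omega> + b * X s \<omega>)\<^sup>2) =
      (\<lambda>\<omega>. a\<^sup>2 * (X t \<omega> * X t \<omega>) + 2 * a * b * (X t \<omega> * X s \<omega>) + b\<^sup>2 * (X s \<omega> * X s \<omega>))"
    by (simp add: power2_eq_square algebra_simps fun_eq_iff)
  then show ?thesis
    using X_mult_integrable t s by (simp add: k_eq)
qed

lemma k_nonneg: "t \<in> {0..1} \<Longrightarrow> 0 \<le> k t t"
  by (simp add: k_eq)

text \<open>The link to the abstract estimates: the variance of the functional under the scaled law
  is a quadratic form in \<open>k\<close>. Choices of \<open>a\<close> and \<open>b\<close> later
  give sums, increments and signed values.\<close>

lemma combination_gaussian_functional_LDP:
  assumes t: "t \<in> {0..1}" and s: "s \<in> {0..1}"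
  shows "gaussian_functional_LDP C01 (\<lambda>\<epsilon>. distr M (borel_of_topology C01) (scaled_path X \<epsilon>)) g I
    (\<lambda>x. a * x t + b * x s)
    (\<lambda>\<epsilon>. a\<^sup>2 * k (\<epsilon> * t) (\<epsilon> * t) + 2 * a * b * k (\<epsilon> * t) (\<epsilon> * s) + b\<^sup>2 * k (\<epsilon> * s) (\<epsilon> * s))"
proof -
  let ?\<phi> = "\<lambda>x :: real \<Rightarrow> real. a * x t + b * x s"
  let ?B = "borel_of_topology C01"
  have meas: "scaled_path X \<epsilon> \<in> measurable M ?B" if "\<epsilon> \<in> {0<..1}" for \<epsilon>
    using small_time_LDP that by (simp add: small_time_LDP_def)
  have cont: "continuous_map C01 euclideanreal ?\<phi>"
    using C01_eval_continuous[OF t] C01_eval_continuous[OF s]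
    by (intro continuous_intros) auto
  have space_B: "space ?B = topspace C01"
    by (simp add: borel_of_topology_def space_measure_of_conv)
  have \<phi>: "?\<phi> \<in> borel_measurable ?B"
  proof (rule borel_measurableI)
    fix S :: "real set" assume "open S"
    then have "openin C01 {x \<in> topspace C01. ?\<phi> x \<in> S}"
      by (intro openin_continuous_map_preimage[OF cont]) simp
    then show "?\<phi> -` S \<inter> space ?B \<in> sets ?B"
      by (auto simp: space_B vimage_def Int_def conj_commute dest: openin_sets_borel_of_topology)
  qed
  have unit: "\<epsilon> * u \<in> {0..1}" if "\<epsilon> \<in> {0<..1}" "u \<in> {0..1}" for \<epsilon> u :: real
    using that by (auto intro: mult_le_one)
  have path: "?\<phi> (scaled_path X \<epsilon> \<omega>) = a * X (\<epsilon> * t) \<omega> + b * X (\<epsilon> * s) \<omega>" for \<epsilon> \<omega>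
    using t s by (simp add: scaled_path_def)
  show ?thesis
  proof (rule gaussian_functional_LDP.intro)
    show "satisfies_LDP C01 (\<lambda>\<epsilon>. distr M ?B (scaled_path X \<epsilon>)) g I"
      using small_time_LDP by (simp add: small_time_LDP_def)
    show "continuous_map C01 euclideanreal ?\<phi>" by (rule cont)
    fix \<epsilon> :: real assume \<epsilon>: "\<epsilon> \<in> {0<..1}"
    note u = unit[OF \<epsilon> t] unit[OF \<epsilon> s]
    show "prob_space (distr M ?B (scaled_path X \<epsilon>))"
      by (rule prob_space_distr[OF meas[OF \<epsilon>]])
    show "space (distr M ?B (scaled_path X \<epsilon>)) = topspace C01"
      by (simp only: space_distr space_B)
    show "gaussian_rv (distr M ?B (scaled_path X \<epsilon>)) ?\<phi>"
      unfolding gaussian_rv_distr[OF meas[OF \<epsilon>] \<phi>] path by (rule gaussian_combination[OF u])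
    show "integral\<^sup>L (distr M ?B (scaled_path X \<epsilon>)) ?\<phi> = 0"
      unfolding integral_distr[OF meas[OF \<epsilon>] \<phi>] path
      by (simp add: X_integrable[OF u(1)] X_integrable[OF u(2)] X_centered[OF u(1)] X_centered[OF u(2)])
    show "a\<^sup>2 * k (\<epsilon> * t) (\<epsilon> * t) + 2 * a * b * k (\<epsilon> * t) (\<epsilon> * s) + b\<^sup>2 * k (\<epsilon> * s) (\<epsilon> * s) =
        (\<integral>x. (?\<phi> x)\<^sup>2 \<partial>distr M ?B (scaled_path X \<epsilon>))"
      using integral_distr[OF meas[OF \<epsilon>] borel_measurable_power[OF \<phi>, of 2]]
      unfolding path by (simp add: expectation_combination_squared[OF u])
  qed
qed

text \<open>\<open>Lim\<close> makes this total; it is shown to be a genuine limit on the unit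
  square and, when \<open>K 1 1 > 0\<close>, for all nonnegative times.\<close>

definition K :: "real \<Rightarrow> real \<Rightarrow> real" where
  "K t s = Lim (at_right 0) (\<lambda>\<epsilon>. g \<epsilon> * k (\<epsilon> * t) (\<epsilon> * s))"

lemma K_eqI: "((\<lambda>\<epsilon>. g \<epsilon> * k (\<epsilon> * t) (\<epsilon> * s)) \<longlongrightarrow> l) (at_right 0) \<Longrightarrow> K t s = l"
  unfolding K_def by (intro tendsto_Lim) auto

lemma scaled_combination_convergent:
  assumes t: "t \<in> {0..1}" and s: "s \<in> {0..1}"
  obtains l where "((\<lambda>\<epsilon>. g \<epsilon> * (a\<^sup>2 * k (\<epsilon> * t) (\<epsilon> * t) + 2 * a * b * k (\<epsilon> * t) (\<epsilon> * s)
    + b\<^sup>2 * k (\<epsilon> * s) (\<epsilon> * s))) \<longlongrightarrow> l) (at_right 0)"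
  using gaussian_functional_LDP.scaled_variance_tendsto[OF combination_gaussian_functional_LDP[OF t s]]
  by blast

text \<open>Polarisation: the scaled variances of \<open>x t + x s\<close>, \<open>x t\<close> and
  \<open>x s\<close> converge, and the covariance is half of the first minus the other two.\<close>

lemma scaled_covariance_tendsto:
  assumes t: "t \<in> {0..1}" and s: "s \<in> {0..1}"
  shows "((\<lambda>\<epsilon>. g \<epsilon> * k (\<epsilon> * t) (\<epsilon> * s)) \<longlongrightarrow> K t s) (at_right 0)"
proof -
  obtain l1 where l1: "((\<lambda>\<epsilon>. g \<epsilon> * (k (\<epsilon> * t) (\<epsilon> * t) + 2 * k (\<epsilon> * t) (\<epsilon> * s) + k (\<epsilon> * s) (\<epsilon> * s)))
      \<longlongrightarrow> l1) (at_right 0)"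
    by (rule scaled_combination_convergent[OF t s, of 1 1]) simp
  obtain l2 where l2: "((\<lambda>\<epsilon>. g \<epsilon> * k (\<epsilon> * t) (\<epsilon> * t)) \<longlongrightarrow> l2) (at_right 0)"
    by (rule scaled_combination_convergent[OF t t, of 1 0]) simp
  obtain l3 where l3: "((\<lambda>\<epsilon>. g \<epsilon> * k (\<epsilon> * s) (\<epsilon> * s)) \<longlongrightarrow> l3) (at_right 0)"
    by (rule scaled_combination_convergent[OF s s, of 1 0]) simp
  have "((\<lambda>\<epsilon>. g \<epsilon> * k (\<epsilon> * t) (\<epsilon> * s)) \<longlongrightarrow> (l1 - l2 - l3) / 2) (at_right 0)"
    using tendsto_divide[OF tendsto_diff[OF tendsto_diff[OF l1 l2] l3] tendsto_const[of 2]]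
    by (simp add: algebra_simps)
  with K_eqI[OF this] show ?thesis by (simp only:)
qed

lemma scaled_combination_tendsto:
  assumes t: "t \<in> {0..1}" and s: "s \<in> {0..1}"
  shows "((\<lambda>\<epsilon>. g \<epsilon> * (a\<^sup>2 * k (\<epsilon> * t) (\<epsilon> * t) + 2 * a * b * k (\<epsilon> * t) (\<epsilon> * s) + b\<^sup>2 * k (\<epsilon> * s) (\<epsilon> * s)))
    \<longlongrightarrow> a\<^sup>2 * K t t + 2 * a * b * K t s + b\<^sup>2 * K s s) (at_right 0)"
proof -
  have "((\<lambda>\<epsilon>. a\<^sup>2 * (g \<epsilon> * k (\<epsilon> * t) (\<epsilon> * t)) + 2 * a * b * (g \<epsilon> * k (\<epsilon> * t) (\<epsilon> * s))
      + b\<^sup>2 * (g \<epsilon> * k (\<epsilon> * s) (\<epsilon> * s)))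
    \<longlongrightarrow> a\<^sup>2 * K t t + 2 * a * b * K t s + b\<^sup>2 * K s s) (at_right 0)"
    using t s by (intro tendsto_intros scaled_covariance_tendsto) auto
  then show ?thesis by (simp add: algebra_simps)
qed

section \<open>Positive semidefiniteness, continuity and nondegeneracy of the limit kernel\<close>

lemma g_pos: "0 < \<epsilon> \<Longrightarrow> 0 < g \<epsilon>"
  and g_at_top: "filterlim g at_top (at_right 0)"
  using small_time_LDP
  by (auto simp: small_time_LDP_def satisfies_LDP_def speed_function_def)

lemma K_quadratic_form_nonneg:
  assumes t: "t \<in> {0..1}" and s: "s \<in> {0..1}"
  shows "0 \<le> a\<^sup>2 * K t t + 2 * a * b * K t s + b\<^sup>2 * K s s"
proof -
  interpret gaussian_functional_LDP C01 "\<lambda>\<epsilon>. distr M (borel_of_topology C01) (scaled_path X \<epsilon>)" g I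
    "\<lambda>x. a * x t + b * x s"
    "\<lambda>\<epsilon>. a\<^sup>2 * k (\<epsilon> * t) (\<epsilon> * t) + 2 * a * b * k (\<epsilon> * t) (\<epsilon> * s) + b\<^sup>2 * k (\<epsilon> * s) (\<epsilon> * s)"
    by (rule combination_gaussian_functional_LDP[OF t s])
  have "\<forall>\<^sub>F \<epsilon> in at_right 0. 0 \<le> g \<epsilon> * (a\<^sup>2 * k (\<epsilon> * t) (\<epsilon> * t) + 2 * a * b * k (\<epsilon> * t) (\<epsilon> * s) + b\<^sup>2 * k (\<epsilon> * s) (\<epsilon> * s))"
    using eventually_at_right_unit
    by eventually_elim (intro mult_nonneg_nonneg v_nonneg less_imp_le[OF g_pos], auto)
  then show ?thesis
    using scaled_combination_tendsto[OF t s] by (intro tendsto_lowerbound) auto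
qed

lemma K_nonneg: "t \<in> {0..1} \<Longrightarrow> 0 \<le> K t t"
  using K_quadratic_form_nonneg[of t t 1 0] by simp

lemma K_Cauchy_Schwarz:
  assumes t: "t \<in> {0..1}" and s: "s \<in> {0..1}"
  shows "\<bar>K t s\<bar> \<le> sqrt (K t t) * sqrt (K s s)"
proof -
  have *: "(K t s)\<^sup>2 \<le> K t t * K s s"
  proof (cases "K s s = 0")
    case True
    have "K t s = 0"
    proof (rule ccontr)
      assume "K t s \<noteq> 0"
      \<comment> \<open>With this choice of \<open>b\<close> the form equals
        \<open>- K t t - 2\<close>, which is negative.\<close>
      then show False
        using K_quadratic_form_nonneg[OF t s, of 1 "- (K t t + 1) / K t s"] K_nonneg[OF t] True by simp
    qed
    with True show ?thesis by simp
  next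
    case False
    with K_nonneg[OF s] have pos: "0 < K s s" by simp
    \<comment> \<open>The choice \<open>a = K s s\<close>, \<open>b = - K t s\<close> turns the form
      into \<open>K s s\<close> times the two-point determinant.\<close>
    have "0 \<le> (K s s)\<^sup>2 * K t t + 2 * K s s * (- K t s) * K t s + (- K t s)\<^sup>2 * K s s"
      by (rule K_quadratic_form_nonneg[OF t s])
    also have "\<dots> = K s s * (K t t * K s s - (K t s)\<^sup>2)"
      by (simp add: power2_eq_square algebra_simps)
    finally show ?thesis using pos by (simp add: zero_le_mult_iff)
  qed
  have "sqrt ((K t s)\<^sup>2) \<le> sqrt (K t t * K s s)"
    using * by (rule real_sqrt_le_mono)
  then show ?thesis by (simp add: real_sqrt_mult)
qed

text \<open>The canonical metric of the limit kernel inherits equicontinuity from the compact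
  level set \<open>I \<le> 1\<close>, on which increments stay below any threshold.\<close>

lemma K_diagonal_tendsto:
  assumes s: "s \<in> {0..1}"
  shows "((\<lambda>t. K t t) \<longlongrightarrow> K s s) (at s within {0..1})"
proof -
  have "((\<lambda>t. sqrt (K t t)) \<longlongrightarrow> sqrt (K s s)) (at s within {0..1})"
  proof (rule tendstoI)
    fix e :: real assume "0 < e"
    define \<eta> where "\<eta> = e / 2"
    have \<eta>: "0 < \<eta>" "\<eta> < e" using \<open>0 < e\<close> by (auto simp: \<eta>_def)
    have "compactin C01 {x \<in> topspace C01. I x \<le> 1}"
      using small_time_LDP
      by (auto simp: small_time_LDP_def satisfies_LDP_def rate_function_def one_ereal_def)
    then obtain \<delta> where \<delta>: "0 < \<delta>" "\<And>x t. x \<in> {x \<in> topspace C01. I x \<le> 1} \<Longrightarrow> t \<in> {0..1} \<Longrightarrow>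
      \<bar>t - s\<bar> < \<delta> \<Longrightarrow> \<bar>x t - x s\<bar> < \<eta>"
      by (rule compactin_C01_equicontinuous[OF _ \<eta>(1) s], intro that)
    have "dist (sqrt (K t t)) (sqrt (K s s)) < e" if t: "t \<in> {0..1}" and ts: "\<bar>t - s\<bar> < \<delta>" for t
    proof -
      interpret gaussian_functional_LDP C01 "\<lambda>\<epsilon>. distr M (borel_of_topology C01) (scaled_path X \<epsilon>)" g I
        "\<lambda>x. 1 * x t + (- 1) * x s"
        "\<lambda>\<epsilon>. 1\<^sup>2 * k (\<epsilon> * t) (\<epsilon> * t) + 2 * 1 * (- 1) * k (\<epsilon> * t) (\<epsilon> * s) + (- 1)\<^sup>2 * k (\<epsilon> * s) (\<epsilon> * s)"
        by (rule combination_gaussian_functional_LDP[OF t s])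
      have "1\<^sup>2 * K t t + 2 * 1 * (- 1) * K t s + (- 1)\<^sup>2 * K s s \<le> \<eta>\<^sup>2"
      proof (rule scaled_variance_limit_le[OF scaled_combination_tendsto[OF t s] \<eta>(1)])
        fix x assume "x \<in> topspace C01" "I x \<le> 1"
        with \<delta>(2)[OF _ t ts, of x] show "1 * x t + - 1 * x s < \<eta>"
          by (simp del: topspace_mtopology_of)
      qed
      \<comment> \<open>By Cauchy-Schwarz the square roots differ by at most the canonical distance
        of \<open>t\<close> and \<open>s\<close>.\<close>
      moreover have "(sqrt (K t t) - sqrt (K s s))\<^sup>2 = K t t + K s s - 2 * (sqrt (K t t) * sqrt (K s s))"
        using K_nonneg[OF t] K_nonneg[OF s] by (simp add: power2_diff)
      ultimately have "(sqrt (K t t) - sqrt (K s s))\<^sup>2 \<le> \<eta>\<^sup>2"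
        using K_Cauchy_Schwarz[OF t s] by (simp add: abs_le_iff)
      then have "\<bar>sqrt (K t t) - sqrt (K s s)\<bar> \<le> \<eta>"
        using \<eta> by (simp add: abs_le_square_iff[symmetric])
      with \<eta> show ?thesis by (simp add: dist_real_def)
    qed
    with \<delta>(1) show "\<forall>\<^sub>F t in at s within {0..1}. dist (sqrt (K t t)) (sqrt (K s s)) < e"
      by (auto simp: eventually_at dist_real_def intro!: exI[of _ \<delta>])
  qed
  then have "((\<lambda>t. (sqrt (K t t))\<^sup>2) \<longlongrightarrow> (sqrt (K s s))\<^sup>2) (at s within {0..1})"
    by (rule tendsto_power)
  then have "((\<lambda>t. (sqrt (K t t))\<^sup>2) \<longlongrightarrow> K s s) (at s within {0..1})"
    using K_nonneg[OF s] by simp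
  then show ?thesis
    by (rule Lim_transform_eventually)
      (auto simp: eventually_at_filter K_nonneg)
qed

text \<open>At time 0 the scaled covariance is \<open>g \<epsilon> * k 0 0\<close>; it converges
  although \<open>g\<close> tends to infinity, so \<open>k 0 0 = 0\<close>.\<close>

lemma K_zero: "K 0 0 = 0"
proof (rule K_eqI)
  have lim: "((\<lambda>\<epsilon>. g \<epsilon> * k 0 0) \<longlongrightarrow> K 0 0) (at_right 0)"
    using scaled_covariance_tendsto[of 0 0] by simp
  have "((\<lambda>\<epsilon>. inverse (g \<epsilon>)) \<longlongrightarrow> 0) (at_right 0)"
    by (rule filterlim_compose[OF tendsto_inverse_0_at_top g_at_top]) (rule filterlim_ident)
  from tendsto_mult[OF lim this] have "((\<lambda>\<epsilon>. g \<epsilon> * k 0 0 * inverse (g \<epsilon>)) \<longlongrightarrow> 0) (at_right 0)"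
    by simp
  then have "((\<lambda>\<epsilon>::real. k 0 0) \<longlongrightarrow> 0) (at_right 0)"
    by (rule Lim_transform_eventually)
      (use eventually_at_right_less[of 0] in \<open>eventually_elim, use g_pos in force\<close>)
  then have "k 0 0 = 0"
    by (simp add: tendsto_const_iff)
  then show "((\<lambda>\<epsilon>. g \<epsilon> * k (\<epsilon> * 0) (\<epsilon> * 0)) \<longlongrightarrow> 0) (at_right 0)"
    by simp
qed

lemma variance_tendsto_0: "((\<lambda>\<epsilon>. k \<epsilon> \<epsilon>) \<longlongrightarrow> 0) (at_right 0)"
proof -
  have lim: "((\<lambda>\<epsilon>. g \<epsilon> * k \<epsilon> \<epsilon>) \<longlongrightarrow> K 1 1) (at_right 0)"
    using scaled_covariance_tendsto[of 1 1] by simp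
  have "((\<lambda>\<epsilon>. inverse (g \<epsilon>)) \<longlongrightarrow> 0) (at_right 0)"
    by (rule filterlim_compose[OF tendsto_inverse_0_at_top g_at_top]) (rule filterlim_ident)
  from tendsto_mult[OF lim this] have "((\<lambda>\<epsilon>. g \<epsilon> * k \<epsilon> \<epsilon> * inverse (g \<epsilon>)) \<longlongrightarrow> 0) (at_right 0)"
    by simp
  then show ?thesis
    by (rule Lim_transform_eventually)
      (use eventually_at_right_less[of 0] in \<open>eventually_elim, use g_pos in force\<close>)
qed

text \<open>If \<open>K 1 1 = 0 < K t t\<close>, then the variance would increase along \<open>\<epsilon>, \<epsilon> t, \<epsilon> t\<^sup>2, \<dots>\<close>,
  although it tends to \<open>0\<close>.\<close>

lemma K_diagonal_degenerate:
  assumes K1: "K 1 1 = 0" and t: "t \<in> {0..1}"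
  shows "K t t = 0"
proof (rule ccontr)
  assume "K t t \<noteq> 0"
  with K_nonneg[OF t] have pos: "0 < K t t" by simp
  with K1 K_zero t have t01: "0 < t" "t < 1" by (auto simp: order.order_iff_strict)
  have "((\<lambda>\<epsilon>. g \<epsilon> * k (\<epsilon> * t) (\<epsilon> * t) - g \<epsilon> * k \<epsilon> \<epsilon>) \<longlongrightarrow> K t t - K 1 1) (at_right 0)"
    using scaled_covariance_tendsto[OF t t] scaled_covariance_tendsto[of 1 1]
    by (intro tendsto_diff) auto
  then have "\<forall>\<^sub>F \<epsilon> in at_right 0. 0 < g \<epsilon> * k (\<epsilon> * t) (\<epsilon> * t) - g \<epsilon> * k \<epsilon> \<epsilon>"
    by (rule order_tendstoD) (use pos K1 in auto)
  then have "\<forall>\<^sub>F \<epsilon> in at_right 0. k \<epsilon> \<epsilon> < k (\<epsilon> * t) (\<epsilon> * t)"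
    using eventually_at_right_less[of 0]
    by eventually_elim (use g_pos in \<open>auto simp: mult_less_cancel_left_pos\<close>)
  then obtain b where b: "0 < b" "\<And>\<epsilon>. 0 < \<epsilon> \<Longrightarrow> \<epsilon> < b \<Longrightarrow> k \<epsilon> \<epsilon> < k (\<epsilon> * t) (\<epsilon> * t)"
    by (auto simp: eventually_at_right_field)
  define \<epsilon> where "\<epsilon> = min 1 (b / 2)"
  have \<epsilon>: "0 < \<epsilon>" "\<epsilon> \<le> 1" "\<epsilon> < b" using b(1) by (auto simp: \<epsilon>_def)
  define x where "x n = \<epsilon> * t ^ n" for n
  have x: "0 < x n" "x n < b" for n
  proof -
    show "0 < x n" using \<epsilon> t01 by (simp add: x_def)
    have "x n \<le> \<epsilon> * 1"
      unfolding x_def using \<epsilon> t01 by (intro mult_left_mono power_le_one) auto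
    with \<epsilon> show "x n < b" by simp
  qed
  have step: "k (x n) (x n) < k (x (Suc n)) (x (Suc n))" for n
    using b(2)[OF x] by (simp add: x_def ac_simps)
  have inc: "incseq (\<lambda>n. k (x n) (x n))"
    using step by (intro incseq_SucI less_imp_le)
  have "x \<longlonglongrightarrow> \<epsilon> * 0"
    unfolding x_def using t01 by (intro tendsto_intros LIMSEQ_realpow_zero) auto
  then have "filterlim x (at_right 0) sequentially"
    using x by (intro tendsto_imp_filterlim_at_right) auto
  then have "(\<lambda>n. k (x n) (x n)) \<longlonglongrightarrow> 0"
    by (rule filterlim_compose[OF variance_tendsto_0])
  \<comment> \<open>An increasing sequence with limit 0 is nowhere positive, but this one rises
    strictly from a nonnegative first value.\<close>
  then have "k (x 1) (x 1) \<le> 0"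
    by (rule incseq_le[OF inc])
  moreover have "0 \<le> k (x 0) (x 0)"
    using \<epsilon> by (intro k_nonneg) (auto simp: x_def)
  ultimately show False using step[of 0] by simp
qed

text \<open>A nonzero path of finite rate is nonzero at some \<open>t\<close> in [0,1], which gives
  \<open>K t t > 0\<close>; the degenerate case then excludes \<open>K 1 1 = 0\<close>.\<close>

lemma nontrivial_rate_imp_K_pos:
  assumes "nontrivial_rate I"
  shows "0 < K 1 1"
proof -
  obtain x where x: "x \<in> topspace C01" "x \<noteq> (\<lambda>t\<in>{0..1}. 0)" "I x < \<infinity>"
    using assms by (auto simp: nontrivial_rate_def)
  have "x \<in> extensional {0..1}" using x(1) by simp
  with x(2) obtain t where t: "t \<in> {0..1}" "x t \<noteq> 0"
    by (auto simp: extensional_def fun_eq_iff restrict_def split: if_splits)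
  \<comment> \<open>The sign makes the functional positive at \<open>x\<close>; its square 1 leaves
    \<open>K t t\<close> as the limit variance.\<close>
  let ?a = "sgn (x t)"
  interpret gaussian_functional_LDP C01 "\<lambda>\<epsilon>. distr M (borel_of_topology C01) (scaled_path X \<epsilon>)" g I
    "\<lambda>x. ?a * x t + 0 * x t"
    "\<lambda>\<epsilon>. ?a\<^sup>2 * k (\<epsilon> * t) (\<epsilon> * t) + 2 * ?a * 0 * k (\<epsilon> * t) (\<epsilon> * t) + 0\<^sup>2 * k (\<epsilon> * t) (\<epsilon> * t)"
    by (rule combination_gaussian_functional_LDP[OF t(1) t(1)])
  have "0 < ?a * x t + 0 * x t"
    using t(2) by (simp add: sgn_real_def)
  from scaled_variance_limit_pos[OF scaled_combination_tendsto[OF t(1) t(1)] x(1,3) this]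
  have "K t t \<noteq> 0" by auto
  then have "K 1 1 \<noteq> 0" using K_diagonal_degenerate[OF _ t(1)] by blast
  then show ?thesis using K_nonneg[of 1] by simp
qed

section \<open>Regular variation of the speed and homogeneity\<close>

lemma speed_ratio_tendsto_K:
  assumes K1: "0 < K 1 1" and s: "0 < s" "s \<le> 1"
  shows "((\<lambda>\<epsilon>. g \<epsilon> / g (\<epsilon> * s)) \<longlongrightarrow> K s s / K 1 1) (at_right 0)"
proof -
  have 1: "((\<lambda>\<epsilon>. g \<epsilon> * k (\<epsilon> * s) (\<epsilon> * s)) \<longlongrightarrow> K s s) (at_right 0)"
    using s by (intro scaled_covariance_tendsto) auto
  have "((\<lambda>\<epsilon>. g \<epsilon> * k \<epsilon> \<epsilon>) \<longlongrightarrow> K 1 1) (at_right 0)"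
    using scaled_covariance_tendsto[of 1 1] by simp
  \<comment> \<open>The limit at time 1, read along \<open>\<epsilon> * s\<close>, involves the same
    variance as the first limit, so their quotient leaves only the speeds.\<close>
  from filterlim_compose[OF this filterlim_times_right_at_right_0[OF s(1)]]
  have 2: "((\<lambda>\<epsilon>. g (\<epsilon> * s) * k (\<epsilon> * s) (\<epsilon> * s)) \<longlongrightarrow> K 1 1) (at_right 0)" .
  have "\<forall>\<^sub>F \<epsilon> in at_right 0. 0 < g (\<epsilon> * s) * k (\<epsilon> * s) (\<epsilon> * s)"
    using order_tendstoD(1)[OF 2 K1] .
  then have "\<forall>\<^sub>F \<epsilon> in at_right 0. g \<epsilon> * k (\<epsilon> * s) (\<epsilon> * s) / (g (\<epsilon> * s) * k (\<epsilon> * s) (\<epsilon> * s)) = g \<epsilon> / g (\<epsilon> * s)"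
    by eventually_elim auto
  with tendsto_divide[OF 1 2] K1 show ?thesis
    by (auto elim: Lim_transform_eventually)
qed

text \<open>\<open>F t\<close> is the limit of the speed ratio at \<open>t\<close>. Factoring
  through \<open>g (\<epsilon> * s)\<close> makes it multiplicative, and continuity of the diagonal
  at 0 and 1 supplies the boundary limits that make it a power.\<close>

lemma speed_ratio_tendsto_powr:
  assumes K1: "0 < K 1 1"
  obtains \<beta> where "0 < \<beta>"
    "\<And>c. 0 < c \<Longrightarrow> ((\<lambda>\<epsilon>. g \<epsilon> / g (\<epsilon> * c)) \<longlongrightarrow> c powr \<beta>) (at_right 0)"
proof -
  define F where "F t = K t t / K 1 1" for t
  have mult: "F (s * t) = F s * F t" if st: "0 < s" "s \<le> 1" "0 < t" "t \<le> 1" for s t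
  proof -
    have "((\<lambda>\<epsilon>. g \<epsilon> * k (\<epsilon> * t) (\<epsilon> * t)) \<longlongrightarrow> K t t) (at_right 0)"
      using st by (intro scaled_covariance_tendsto) auto
    from filterlim_compose[OF this filterlim_times_right_at_right_0[OF st(1)]]
    have "((\<lambda>\<epsilon>. g (\<epsilon> * s) * k (\<epsilon> * s * t) (\<epsilon> * s * t)) \<longlongrightarrow> K t t) (at_right 0)" .
    from tendsto_mult[OF speed_ratio_tendsto_K[OF K1 st(1,2)] this]
    have "((\<lambda>\<epsilon>. g \<epsilon> * k (\<epsilon> * (s * t)) (\<epsilon> * (s * t))) \<longlongrightarrow> K s s / K 1 1 * K t t) (at_right 0)"
      by (rule Lim_transform_eventually)
        (use eventually_at_right_less[of 0] in \<open>eventually_elim,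
          use g_pos st in \<open>auto simp: mult.assoc less_imp_neq[THEN not_sym]\<close>\<close>)
    then have "K (s * t) (s * t) = K s s / K 1 1 * K t t"
      by (rule K_eqI)
    then show ?thesis by (simp add: F_def)
  qed
  have lim: "(F \<longlongrightarrow> F s) (at s within {0..1})" if "s \<in> {0..1}" for s
    unfolding F_def using K1 that by (intro tendsto_divide tendsto_const K_diagonal_tendsto) auto
  have F1: "F 1 = 1" and F0: "F 0 = 0"
    using K1 by (auto simp: F_def K_zero)
  have "at (1::real) within {0..1} = at_left 1" "at (0::real) within {0..1} = at_right 0"
    by (simp_all add: at_within_Icc_at_left at_within_Icc_at_right)
  then have "(F \<longlongrightarrow> 1) (at_left 1)" "(F \<longlongrightarrow> 0) (at_right 0)"
    using lim[of 1] lim[of 0] F1 F0 by auto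
  moreover have "0 \<le> F t" if "0 < t" "t \<le> 1" for t
    using K1 K_nonneg[of t] that by (simp add: F_def)
  ultimately obtain \<beta> where \<beta>: "0 < \<beta>" "\<And>t. 0 < t \<Longrightarrow> t < 1 \<Longrightarrow> F t = t powr \<beta>"
    using multiplicative_imp_powr[OF mult] by blast
  have le1: "((\<lambda>\<epsilon>. g \<epsilon> / g (\<epsilon> * c)) \<longlongrightarrow> c powr \<beta>) (at_right 0)" if "0 < c" "c \<le> 1" for c
    using speed_ratio_tendsto_K[OF K1 that] \<beta>(2)[of c] F1 that by (cases "c = 1") (auto simp: F_def)
  show thesis
  proof (rule that[OF \<beta>(1)])
    fix c :: real assume c: "0 < c"
    show "((\<lambda>\<epsilon>. g \<epsilon> / g (\<epsilon> * c)) \<longlongrightarrow> c powr \<beta>) (at_right 0)"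
    proof (cases "c \<le> 1")
      case True
      with c show ?thesis by (rule le1)
    next
      case False
      \<comment> \<open>For \<open>c > 1\<close> the limit for \<open>1 / c\<close>, read along
        \<open>\<epsilon> * c\<close>, is the reciprocal of the one sought.\<close>
      then have "((\<lambda>\<epsilon>. g \<epsilon> / g (\<epsilon> * (1 / c))) \<longlongrightarrow> (1 / c) powr \<beta>) (at_right 0)"
        by (intro le1) auto
      from filterlim_compose[OF this filterlim_times_right_at_right_0[OF c]]
      have "((\<lambda>\<epsilon>. g (\<epsilon> * c) / g \<epsilon>) \<longlongrightarrow> (1 / c) powr \<beta>) (at_right 0)"
        using c by simp
      from tendsto_inverse[OF this] c show ?thesis
        by (simp add: powr_divide)
    qed
  qed
qed

text \<open>Write \<open>g \<epsilon>\<close> as the speed ratio times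
  \<open>g (\<epsilon> * c)\<close> and read the given limit along \<open>\<epsilon> * c\<close>. As
  \<open>c\<close> may exceed 1, this also reaches times beyond 1.\<close>

lemma scaled_covariance_rescale:
  assumes c: "0 < c" and ratio: "((\<lambda>\<epsilon>. g \<epsilon> / g (\<epsilon> * c)) \<longlongrightarrow> r) (at_right 0)"
    and lim: "((\<lambda>\<epsilon>. g \<epsilon> * k (\<epsilon> * t) (\<epsilon> * s)) \<longlongrightarrow> l) (at_right 0)"
  shows "((\<lambda>\<epsilon>. g \<epsilon> * k (\<epsilon> * (c * t)) (\<epsilon> * (c * s))) \<longlongrightarrow> r * l) (at_right 0)"
proof -
  from filterlim_compose[OF lim filterlim_times_right_at_right_0[OF c]]
  have "((\<lambda>\<epsilon>. g (\<epsilon> * c) * k (\<epsilon> * c * t) (\<epsilon> * c * s)) \<longlongrightarrow> l) (at_right 0)" .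
  from tendsto_mult[OF ratio this] show ?thesis
    by (rule Lim_transform_eventually)
      (use eventually_at_right_less[of 0] in \<open>eventually_elim,
        use g_pos c in \<open>auto simp: mult.assoc less_imp_neq[THEN not_sym]\<close>\<close>)
qed

text \<open>If \<open>K 1 1 = 0\<close>, the diagonal vanishes on [0,1] and Cauchy-Schwarz kills
  \<open>K\<close> on the unit square. Otherwise \<open>K\<close> itself serves, with the exponent
  of the speed ratio.\<close>

lemma scaled_covariance_limit:
  obtains \<beta> k0 where "0 < \<beta>"
    "\<And>t s. t \<in> {0..1} \<Longrightarrow> s \<in> {0..1} \<Longrightarrow>
      ((\<lambda>\<epsilon>. g \<epsilon> * k (\<epsilon> * t) (\<epsilon> * s)) \<longlongrightarrow> k0 t s) (at_right 0)"
    "\<And>t. 0 \<le> t \<Longrightarrow> k0 t t = k0 1 1 * t powr \<beta>"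
    "\<And>c t s. 0 < c \<Longrightarrow> 0 \<le> t \<Longrightarrow> 0 \<le> s \<Longrightarrow> k0 (c * t) (c * s) = c powr \<beta> * k0 t s"
    "nontrivial_rate I \<Longrightarrow> 0 < k0 1 1"
    "\<And>t s. nontrivial_rate I \<Longrightarrow> 0 \<le> t \<Longrightarrow> 0 \<le> s \<Longrightarrow>
      ((\<lambda>\<epsilon>. g \<epsilon> * k (\<epsilon> * t) (\<epsilon> * s)) \<longlongrightarrow> k0 t s) (at_right 0)"
    "\<And>c. nontrivial_rate I \<Longrightarrow> 0 < c \<Longrightarrow>
      ((\<lambda>\<epsilon>. g \<epsilon> / g (\<epsilon> * c)) \<longlongrightarrow> c powr \<beta>) (at_right 0)"
proof (cases "K 1 1 = 0")
  case True
  then have triv: "\<not> nontrivial_rate I"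
    using nontrivial_rate_imp_K_pos by auto
  have "K t s = 0" if "t \<in> {0..1}" "s \<in> {0..1}" for t s
    using K_Cauchy_Schwarz[OF that] K_diagonal_degenerate[OF True] that by simp
  with scaled_covariance_tendsto
  have "((\<lambda>\<epsilon>. g \<epsilon> * k (\<epsilon> * t) (\<epsilon> * s)) \<longlongrightarrow> 0) (at_right 0)" if "t \<in> {0..1}" "s \<in> {0..1}" for t s
    using that by metis
  with triv show thesis
    \<comment> \<open>The zero function replaces \<open>K\<close>, whose values beyond the unit
      square are not known here; any positive exponent fits it.\<close>
    by (intro that[of 1 "\<lambda>_ _. 0"]) auto
next
  case False
  with K_nonneg[of 1] have K1: "0 < K 1 1" by simp
  obtain \<beta> where \<beta>: "0 < \<beta>"
    and ratio: "\<And>c. 0 < c \<Longrightarrow> ((\<lambda>\<epsilon>. g \<epsilon> / g (\<epsilon> * c)) \<longlongrightarrow> c powr \<beta>) (at_right 0)"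
    using speed_ratio_tendsto_powr[OF K1] by blast
  have lim: "((\<lambda>\<epsilon>. g \<epsilon> * k (\<epsilon> * t) (\<epsilon> * s)) \<longlongrightarrow> K t s) (at_right 0)" if ts: "0 \<le> t" "0 \<le> s" for t s
  proof -
    \<comment> \<open>Dividing by \<open>c\<close> moves both times into [0,1]; the summand 1 keeps
      \<open>c\<close> positive when both are 0.\<close>
    define c where "c = 1 + t + s"
    have c: "0 < c" "c * (t / c) = t" "c * (s / c) = s" using ts by (auto simp: c_def)
    have "t / c \<in> {0..1}" "s / c \<in> {0..1}" using ts by (auto simp: c_def)
    from scaled_covariance_rescale[OF c(1) ratio[OF c(1)] scaled_covariance_tendsto[OF this]]
    have "((\<lambda>\<epsilon>. g \<epsilon> * k (\<epsilon> * t) (\<epsilon> * s)) \<longlongrightarrow> c powr \<beta> * K (t / c) (s / c)) (at_right 0)"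
      unfolding c(2,3) .
    with K_eqI[OF this] show ?thesis by (simp only:)
  qed
  have hom: "K (c * t) (c * s) = c powr \<beta> * K t s" if "0 < c" "0 \<le> t" "0 \<le> s" for c t s
    using that by (intro K_eqI scaled_covariance_rescale ratio lim)
  have diag: "K t t = K 1 1 * t powr \<beta>" if "0 \<le> t" for t
    using hom[of t 1 1] K_zero that by (cases "t = 0") auto
  show thesis
    by (rule that[OF \<beta> scaled_covariance_tendsto diag hom K1 lim ratio])
qed

end

text \<open>For a speed too slow for the process \<open>k0\<close> is zero, and the equivalence
  would compare a positive \<open>g\<close> with the zero function; hence the last block is
  conditional on \<open>nontrivial_rate I\<close>.\<close>

theorem theorem3p10:
  fixes M :: "'a measure"
    and X :: "real \<Rightarrow> 'a \<Rightarrow> real"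
    and k :: "real \<Rightarrow> real \<Rightarrow> real"
    and g :: "real \<Rightarrow> real"
    and I :: "(real \<Rightarrow> real) \<Rightarrow> ereal"
  assumes "prob_space M"
    and "gaussian_process M {0..1} X"
    and "centered_process M {0..1} X"
    and "continuous_process M {0..1} X"
    and "\<And>t s. t \<in> {0..1} \<Longrightarrow> s \<in> {0..1} \<Longrightarrow> k t s = covariance M (X t) (X s)"
    and "small_time_LDP M X g I"
  shows "\<exists>\<beta>>0. \<exists>k0 :: real \<Rightarrow> real \<Rightarrow> real.
      (\<forall>t\<in>{0..1}. \<forall>s\<in>{0..1}.
         ((\<lambda>\<epsilon>. g \<epsilon> * k (\<epsilon> * t) (\<epsilon> * s)) \<longlongrightarrow> k0 t s) (at_right 0)) \<and>
      (\<forall>t\<ge>0. k0 t t = k0 1 1 * t powr \<beta>) \<and>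
      (\<forall>c>0. \<forall>t\<ge>0. \<forall>s\<ge>0. k0 (c * t) (c * s) = c powr \<beta> * k0 t s) \<and>
      (nontrivial_rate I \<longrightarrow>
         (\<forall>t\<ge>0. \<forall>s\<ge>0.
            ((\<lambda>\<epsilon>. g \<epsilon> * k (\<epsilon> * t) (\<epsilon> * s)) \<longlongrightarrow> k0 t s) (at_right 0)) \<and>
         k0 1 1 > 0 \<and>
         g \<sim>[at_right 0] (\<lambda>\<epsilon>. k0 1 1 / k \<epsilon> \<epsilon>) \<and>
         (\<exists>\<gamma>. regularly_varying_at_0 (\<lambda>t. k t t) \<gamma>) \<and>
         (\<exists>\<gamma>. regularly_varying_at_0 g \<gamma>))"
proof -
  interpret prob_space M by fact
  interpret small_time_gaussian_LDP M X k g I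
    by unfold_locales (use assms in auto)
  obtain \<beta> k0 where \<beta>: "0 < \<beta>"
    and lim01: "\<And>t s. t \<in> {0..1} \<Longrightarrow> s \<in> {0..1} \<Longrightarrow>
      ((\<lambda>\<epsilon>. g \<epsilon> * k (\<epsilon> * t) (\<epsilon> * s)) \<longlongrightarrow> k0 t s) (at_right 0)"
    and diag: "\<And>t. 0 \<le> t \<Longrightarrow> k0 t t = k0 1 1 * t powr \<beta>"
    and hom: "\<And>c t s. 0 < c \<Longrightarrow> 0 \<le> t \<Longrightarrow> 0 \<le> s \<Longrightarrow> k0 (c * t) (c * s) = c powr \<beta> * k0 t s"
    and pos: "nontrivial_rate I \<Longrightarrow> 0 < k0 1 1"
    and lim: "\<And>t s. nontrivial_rate I \<Longrightarrow> 0 \<le> t \<Longrightarrow> 0 \<le> s \<Longrightarrow>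
      ((\<lambda>\<epsilon>. g \<epsilon> * k (\<epsilon> * t) (\<epsilon> * s)) \<longlongrightarrow> k0 t s) (at_right 0)"
    and ratio: "\<And>c. nontrivial_rate I \<Longrightarrow> 0 < c \<Longrightarrow>
      ((\<lambda>\<epsilon>. g \<epsilon> / g (\<epsilon> * c)) \<longlongrightarrow> c powr \<beta>) (at_right 0)"
    by (rule scaled_covariance_limit, intro that)
  have "g \<sim>[at_right 0] (\<lambda>\<epsilon>. k0 1 1 / k \<epsilon> \<epsilon>)"
    and "regularly_varying_at_0 (\<lambda>t. k t t) \<beta>" and "regularly_varying_at_0 g (- \<beta>)"
    if nt: "nontrivial_rate I"
  proof -
    have var: "((\<lambda>\<epsilon>. g \<epsilon> * k \<epsilon> \<epsilon>) \<longlongrightarrow> k0 1 1) (at_right 0)"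
      using lim01[of 1 1] by simp
    from tendsto_divide[OF this tendsto_const[of "k0 1 1"]] pos[OF nt]
    show "g \<sim>[at_right 0] (\<lambda>\<epsilon>. k0 1 1 / k \<epsilon> \<epsilon>)"
      by (intro asymp_equivI') simp
    show "regularly_varying_at_0 (\<lambda>t. k t t) \<beta>"
      unfolding regularly_varying_at_0_def
    proof (intro allI impI)
      fix t :: real assume t: "0 < t"
      \<comment> \<open>The common factor \<open>g \<epsilon>\<close> cancels, so the ratio of
        variances inherits this limit.\<close>
      have "((\<lambda>\<epsilon>. g \<epsilon> * k (\<epsilon> * t) (\<epsilon> * t) / (g \<epsilon> * k \<epsilon> \<epsilon>)) \<longlongrightarrow> k0 t t / k0 1 1) (at_right 0)"
        using pos[OF nt] lim[OF nt] t var by (intro tendsto_divide) auto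
      also have "k0 t t / k0 1 1 = t powr \<beta>"
        using diag[of t] pos[OF nt] t by simp
      finally show "((\<lambda>\<epsilon>. k (\<epsilon> * t) (\<epsilon> * t) / k \<epsilon> \<epsilon>) \<longlongrightarrow> t powr \<beta>) (at_right 0)"
        by (rule Lim_transform_eventually)
          (use eventually_at_right_less[of 0] in \<open>eventually_elim, use g_pos in force\<close>)
    qed
    show "regularly_varying_at_0 g (- \<beta>)"
      unfolding regularly_varying_at_0_def
    proof (intro allI impI)
      fix t :: real assume t: "0 < t"
      \<comment> \<open>This is the inverse of the known speed ratio, hence the index
        \<open>- \<beta>\<close>.\<close>
      then show "((\<lambda>\<epsilon>. g (\<epsilon> * t) / g \<epsilon>) \<longlongrightarrow> t powr (- \<beta>)) (at_right 0)"
        using tendsto_inverse[OF ratio[OF nt t]] by (simp add: powr_minus)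
    qed
  qed
  note asymp = this
  show ?thesis
    by (intro exI[of _ \<beta>] exI[of _ k0] conjI; use \<beta> lim01 diag hom pos lim asymp in blast)
qed

end
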